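(* Let $n\ge 1$ and $1<r<\infty$. For a measurable $F:\mathbb{R}^{n+1}_+\to\mathbb{C}$ define $\mathcal{M}(F)(x,t):=\mathcal{M}(F(\cdot,t))(x)$, where $\mathcal{M}$ is the centered Hardy–Littlewood maximal operator on $\mathbb{R}^n$. Then: (a) for every $1<q<\infty$ there is $C<\infty$ such that $\|\mathcal{A}_r(\mathcal{M}(F))\|_{L^q(\mathbb{R}^n)}\le C\|\mathcal{A}_r(F)\|_{L^q(\mathbb{R}^n)}$ for all $F\in T^q_r$, i.e. $\mathcal{M}:T^q_r\to T^q_r$ is bounded; (b) there is $C<\infty$ such that $\|\mathcal{A}_r(\mathcal{M}(F))\|_{L^{1,\infty}(\mathbb{R}^n)}\le C\|\mathcal{A}_r(F)\|_{L^1(\mathbb{R}^n)}$ for all $F\in T^1_r$, i.e. $\mathcal{M}:T^1_r\to wT^1_r$ is bounded.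
   Context: $\mathbb{R}^{n+1}_+=\mathbb{R}^n\times(0,\infty)$. For measurable $F$ on $\mathbb{R}^{n+1}_+$ and $0<r<\infty$, $\mathcal{A}_r(F)(x):=\left(\int_0^\infty\int_{B(x,t)}|F(y,t)|^r\frac{dy\,dt}{t^{n+1}}\right)^{1/r}$, $x\in\mathbb{R}^n$. The tent space $T^q_r$ ($0<q,r<\infty$) is the space of measurable $F$ with $\mathcal{A}_r(F)\in L^q(\mathbb{R}^n)$, normed by $\|F\|_{T^q_r}=\|\mathcal{A}_r(F)\|_{L^q}$; the weak tent space $wT^q_r$ consists of those $F$ with $\mathcal{A}_r(F)\in L^{q,\infty}(\mathbb{R}^n)$. The centered maximal operator is $\mathcal{M}(f)(x)=\sup_{\tau>0}\frac{1}{|B(x,\tau)|}\int_{B(x,\tau)}|f(y)|\,dy$. *)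

theory Defs
  imports "HOL-Analysis.Analysis"
begin

text \<open>Real powers of extended nonnegative reals (used only with positive exponents):
  \<infinity> powr p = \<infinity>, otherwise the usual real power.\<close>
definition enn_powr :: "ennreal \<Rightarrow> real \<Rightarrow> ennreal" where
  "enn_powr x p = (if x = \<infinity> then \<infinity> else ennreal (enn2real x powr p))"

definition maximal_fn :: "('a::euclidean_space \<Rightarrow> complex) \<Rightarrow> 'a \<Rightarrow> ennreal" where
  "maximal_fn f x = (SUP \<tau>\<in>{0<..}.
     (\<integral>\<^sup>+ y \<in> ball x \<tau>. ennreal (cmod (f y)) \<partial>lebesgue) / emeasure lebesgue (ball x \<tau>))"

definition tent_max :: "('a::euclidean_space \<times> real \<Rightarrow> complex) \<Rightarrow> 'a \<times> real \<Rightarrow> ennreal" where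
  "tent_max F z = maximal_fn (\<lambda>y. F (y, snd z)) (fst z)"

text \<open>Area functional A_r applied to the modulus G = |F| on the upper half space,
  integrating against dy dt / t^(n+1) over the cone {(y,t). t>0, |y-x|<t}.\<close>
definition area_fn :: "real \<Rightarrow> ('a::euclidean_space \<times> real \<Rightarrow> ennreal) \<Rightarrow> 'a \<Rightarrow> ennreal" where
  "area_fn r G x = enn_powr
     (\<integral>\<^sup>+ z \<in> {(y, t). 0 < t \<and> y \<in> ball x t}.
        enn_powr (G z) r / ennreal (snd z ^ (DIM('a) + 1)) \<partial>lebesgue) (1 / r)"

definition Lq_norm :: "real \<Rightarrow> ('a::euclidean_space \<Rightarrow> ennreal) \<Rightarrow> ennreal" where
  "Lq_norm q g = enn_powr (\<integral>\<^sup>+ x. enn_powr (g x) q \<partial>lebesgue) (1 / q)"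

definition weak_L1_norm :: "('a::euclidean_space \<Rightarrow> ennreal) \<Rightarrow> ennreal" where
  "weak_L1_norm g = (SUP s\<in>{0<..}. ennreal s * emeasure lebesgue {x. ennreal s < g x})"

end

(* Write A for the area functional and M for the maximal operator acting in the space variable. The
  local averages f(w,t) = (t^(-n-1) \<integral>_{B(w,t)} |F(y,t)|^r dy)^(1/r) satisfy A(F)(x) = |f(x,.)| in L^r(dt), and
  splitting the radii at t shows A(MF)(x) \<le> C |Mf(x,.)|. The theorem thus reduces to the
  vector-valued Fefferman-Stein inequality for f.

  Put h(x) = |f(x,.)| and S(x) = |Mf(x,.)|. For q \<ge> r one dualizes the weighted estimate
  \<integral> (Mu)^r w \<le> C \<integral> u^r Mw. For q < r and for the weak-type bound one uses
  l^r |{S > l}| \<le> C (l^r |{Mh > l}| + \<integral> min(h,l)^r): on the open set U = {Mh > l} the function f is replaced by its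
  averages over the balls of radius dist(w, complement of U)/2, whose norms are O(l) by
  Minkowski's inequality, and this changes Mf outside U only by a constant factor. The a.e. bound
  h \<le> Mh needed here holds because A(F) is lower semicontinuous. *)
theory Submission
  imports Defs
begin

section \<open>Powers and integrals of extended nonnegative reals\<close>

text \<open>The scalar maximal operator is positive, so the part of f on U offers no cancellation of
  Calderon-Zygmund kind. What replaces it is domination: seen from outside U, that part is
  controlled by its averages over the Whitney balls. The gain is integrability. The averaged
  function lives on U with norm O(l), hence has r-th power integral O(l^r |U|), whereas f itself may
  have no such bound there, and the L^r inequality can be applied to it. U is cut at a level of Mh
  rather than of h because a Whitney ball is compared with a ball centred at a nearest point of the
  complement, where the averages of h at all radii are at most l. The truncation min(h,l) makes the
  level estimate integrable against l^(q-1-r) dl for q < r; for q > r this integral diverges, which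
  is why duality takes over there. A separate obstacle is measurability: F is only Lebesgue
  measurable on the product, so single slices F(.,t) may be bad. A Borel representative is
  substituted at the cost of a null set of t.\<close>

lemma measurable_enn_powr [measurable]:
  assumes [measurable]: "f \<in> borel_measurable M"
  shows "(\<lambda>x. enn_powr (f x) p) \<in> borel_measurable M"
  unfolding enn_powr_def infinity_ennreal_def by measurable

lemma enn_powr_ennreal: "0 \<le> a \<Longrightarrow> enn_powr (ennreal a) p = ennreal (a powr p)"
  by (simp add: enn_powr_def)

lemma enn_powr_top [simp]: "enn_powr top p = top"
  by (simp add: enn_powr_def)

lemma enn_powr_0 [simp]: "enn_powr 0 p = 0"
  by (simp add: enn_powr_def)

lemma enn_powr_1 [simp]: "enn_powr x 1 = x"
  by (cases x) (auto simp: enn_powr_ennreal)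

lemma enn_powr_one [simp]: "enn_powr 1 p = 1"
  by (simp add: enn_powr_def)

lemma enn_powr_eq_0_iff [simp]: "enn_powr x p = 0 \<longleftrightarrow> x = 0"
  by (cases x) (auto simp: enn_powr_ennreal)

lemma enn_powr_eq_top_iff [simp]: "enn_powr x p = top \<longleftrightarrow> x = top"
  by (cases x) (auto simp: enn_powr_ennreal)

lemma enn_powr_less_top_iff [simp]: "enn_powr x p < top \<longleftrightarrow> x < top"
  by (simp add: less_top[symmetric])

lemma enn_powr_powr: "enn_powr (enn_powr x a) b = enn_powr x (a * b)"
  by (cases x) (auto simp: enn_powr_ennreal powr_powr)

lemma enn_powr_powr_inverse [simp]:
  "p \<noteq> 0 \<Longrightarrow> enn_powr (enn_powr x p) (1 / p) = x" "p \<noteq> 0 \<Longrightarrow> enn_powr (enn_powr x (1 / p)) p = x"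
  by (simp_all add: enn_powr_powr)

text \<open>The exponent is unrestricted because \<open>enn_powr\<close> fixes 0 and top for every
  p, in accordance with 0 * top = 0. The same conventions make \<open>enn_powr_add\<close>
  unconditional.\<close>

lemma enn_powr_mult: "enn_powr (x * y) p = enn_powr x p * enn_powr y p"
proof (cases "x = top \<or> y = top")
  case True
  then show ?thesis
    by (auto simp: ennreal_top_mult ennreal_mult_top)
next
  case False
  then obtain a b where "x = ennreal a" "y = ennreal b" "0 \<le> a" "0 \<le> b"
    by (metis ennreal_cases)
  then show ?thesis
    by (simp add: ennreal_mult[symmetric] enn_powr_ennreal powr_mult)
qed

lemma enn_powr_add: "enn_powr x (a + b) = enn_powr x a * enn_powr x b"
  by (cases x) (auto simp: enn_powr_ennreal powr_add ennreal_mult ennreal_top_mult)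

lemma enn_powr_inverse:
  assumes "0 < p"
  shows "enn_powr (inverse x) p = inverse (enn_powr x p)"
proof (cases "x = 0 \<or> x = top")
  case True
  then show ?thesis
    by auto
next
  case False
  then obtain a where "x = ennreal a" "0 < a"
    by (metis ennreal_cases ennreal_0 order_le_less)
  then show ?thesis
    using assms by (simp add: inverse_ennreal enn_powr_ennreal powr_minus inverse_powr)
qed

lemma enn_powr_divide: "0 < p \<Longrightarrow> enn_powr (x / y) p = enn_powr x p / enn_powr y p"
  by (simp add: divide_ennreal_def enn_powr_mult enn_powr_inverse)

lemma enn_powr_mono:
  assumes "x \<le> y" "0 \<le> p"
  shows "enn_powr x p \<le> enn_powr y p"
proof (cases "y = top")
  case False
  then obtain b where b: "y = ennreal b" "0 \<le> b"
    by (metis ennreal_cases)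
  with assms obtain a where "x = ennreal a" "0 \<le> a"
    by (metis ennreal_cases top.extremum_uniqueI ennreal_neq_top)
  with b assms show ?thesis
    by (simp add: enn_powr_ennreal ennreal_leI powr_mono2)
qed auto

lemma enn_powr_le_iff:
  assumes "0 < p"
  shows "enn_powr x p \<le> enn_powr y p \<longleftrightarrow> x \<le> y"
  using enn_powr_mono[of x y p] enn_powr_mono[of "enn_powr x p" "enn_powr y p" "1 / p"] assms by auto

lemma enn_powr_less_iff: "0 < p \<Longrightarrow> enn_powr x p < enn_powr y p \<longleftrightarrow> x < y"
  by (simp add: enn_powr_le_iff flip: not_le)

lemma enn_powr_SUP:
  assumes "0 < p"
  shows "enn_powr (SUP i\<in>I. f i) p = (SUP i\<in>I. enn_powr (f i) p)"
proof (rule antisym)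
  have "f i \<le> enn_powr (SUP i\<in>I. enn_powr (f i) p) (1 / p)" if "i \<in> I" for i
    using enn_powr_mono[OF SUP_upper[OF that, of "\<lambda>i. enn_powr (f i) p"], of "1 / p"] assms by simp
  then have "(SUP i\<in>I. f i) \<le> enn_powr (SUP i\<in>I. enn_powr (f i) p) (1 / p)"
    by (rule SUP_least)
  from enn_powr_mono[OF this, of p] assms
  show "enn_powr (SUP i\<in>I. f i) p \<le> (SUP i\<in>I. enn_powr (f i) p)"
    by simp
qed (auto intro!: SUP_least enn_powr_mono SUP_upper simp: assms less_imp_le)

lemma enn_powr_plus_le:
  assumes "0 \<le> p"
  shows "enn_powr (x + y) p \<le> enn_powr 2 p * (enn_powr x p + enn_powr y p)"
proof -
  have "x + y \<le> 2 * max x y"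
    by (simp add: add_mono mult_2)
  then have "enn_powr (x + y) p \<le> enn_powr 2 p * enn_powr (max x y) p"
    using enn_powr_mono[of "x + y" "2 * max x y" p] assms by (simp add: enn_powr_mult)
  also have "\<dots> \<le> enn_powr 2 p * (enn_powr x p + enn_powr y p)"
    by (intro mult_left_mono) (auto simp: max_def)
  finally show ?thesis .
qed

section \<open>Inequalities of Young, Holder and Minkowski\<close>

lemma Youngs_inequality_ennreal:
  assumes "0 < a" "0 < b" "a + b = 1"
  shows "enn_powr x a * enn_powr y b \<le> ennreal a * x + ennreal b * y"
proof (cases "x = 0 \<or> y = 0 \<or> x = top \<or> y = top")
  case True
  then show ?thesis
    using assms by (auto simp: ennreal_mult_top)
next
  case False
  then obtain u v where "x = ennreal u" "0 < u" "y = ennreal v" "0 < v"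
    by (metis ennreal_cases ennreal_0 order_le_less)
  then show ?thesis
    using Youngs_inequality_0[of a b u v] assms
    by (simp add: enn_powr_ennreal ennreal_mult[symmetric] ennreal_plus[symmetric] ennreal_leI
        del: ennreal_plus)
qed

text \<open>The exponents are the reciprocals of a conjugate pair and sit on the integrals, so f and
  g stand for functions already raised to their powers. After division by the two integrals, Young's
  inequality integrates to a + b = 1.\<close>

lemma nn_integral_Holder:
  assumes [measurable]: "f \<in> borel_measurable M" "g \<in> borel_measurable M"
    and ab: "0 < a" "0 < b" "a + b = 1"
  shows "(\<integral>\<^sup>+x. enn_powr (f x) a * enn_powr (g x) b \<partial>M)
    \<le> enn_powr (\<integral>\<^sup>+x. f x \<partial>M) a * enn_powr (\<integral>\<^sup>+x. g x \<partial>M) b"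
proof -
  define F G where "F = (\<integral>\<^sup>+x. f x \<partial>M)" and "G = (\<integral>\<^sup>+x. g x \<partial>M)"
  consider "F = 0" | "G = 0" | "F \<noteq> 0" "G \<noteq> 0" "F = top \<or> G = top"
    | "F \<noteq> 0" "G \<noteq> 0" "F \<noteq> top" "G \<noteq> top"
    by blast
  then show ?thesis
    unfolding F_def[symmetric] G_def[symmetric]
  proof cases
    case 1
    then have "AE x in M. f x = 0"
      by (simp add: F_def nn_integral_0_iff_AE)
    then have "(\<integral>\<^sup>+x. enn_powr (f x) a * enn_powr (g x) b \<partial>M) = 0"
      by (subst nn_integral_0_iff_AE) auto
    then show "(\<integral>\<^sup>+x. enn_powr (f x) a * enn_powr (g x) b \<partial>M) \<le> enn_powr F a * enn_powr G b"
      by simp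
  next
    case 2
    then have "AE x in M. g x = 0"
      by (simp add: G_def nn_integral_0_iff_AE)
    then have "(\<integral>\<^sup>+x. enn_powr (f x) a * enn_powr (g x) b \<partial>M) = 0"
      by (subst nn_integral_0_iff_AE) auto
    then show "(\<integral>\<^sup>+x. enn_powr (f x) a * enn_powr (g x) b \<partial>M) \<le> enn_powr F a * enn_powr G b"
      by simp
  next
    case 3
    then have "enn_powr F a * enn_powr G b = top"
      by (auto simp: ennreal_mult_eq_top_iff)
    then show "(\<integral>\<^sup>+x. enn_powr (f x) a * enn_powr (g x) b \<partial>M) \<le> enn_powr F a * enn_powr G b"
      by simp
  next
    case 4
    have canc: "u = u / c * c" if "c \<noteq> 0" "c \<noteq> top" for u c :: ennreal
      using that top.not_eq_extremum[of c] by (simp add: ennreal_divide_times)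
    have "(\<integral>\<^sup>+x. enn_powr (f x) a * enn_powr (g x) b \<partial>M)
        = (\<integral>\<^sup>+x. (enn_powr (f x / F) a * enn_powr (g x / G) b) * (enn_powr F a * enn_powr G b) \<partial>M)"
    proof (rule nn_integral_cong)
      fix x
      have "enn_powr (f x) a = enn_powr (f x / F) a * enn_powr F a"
        "enn_powr (g x) b = enn_powr (g x / G) b * enn_powr G b"
        using canc 4 by (metis enn_powr_mult)+
      then show "enn_powr (f x) a * enn_powr (g x) b
          = (enn_powr (f x / F) a * enn_powr (g x / G) b) * (enn_powr F a * enn_powr G b)"
        by (simp add: ac_simps)
    qed
    also have "\<dots> = (\<integral>\<^sup>+x. enn_powr (f x / F) a * enn_powr (g x / G) b \<partial>M) * (enn_powr F a * enn_powr G b)"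
      by (rule nn_integral_multc) measurable
    also have "\<dots> \<le> (\<integral>\<^sup>+x. ennreal a * (f x / F) + ennreal b * (g x / G) \<partial>M) * (enn_powr F a * enn_powr G b)"
      by (intro mult_right_mono nn_integral_mono Youngs_inequality_ennreal ab) auto
    also have "(\<integral>\<^sup>+x. ennreal a * (f x / F) + ennreal b * (g x / G) \<partial>M)
        = ennreal a * (F / F) + ennreal b * (G / G)"
      by (simp add: nn_integral_add nn_integral_cmult nn_integral_divide F_def G_def)
    also have "\<dots> = 1"
      using 4 ab top.not_eq_extremum[of F] top.not_eq_extremum[of G]
      by (simp flip: ennreal_plus)
    finally show "(\<integral>\<^sup>+x. enn_powr (f x) a * enn_powr (g x) b \<partial>M) \<le> enn_powr F a * enn_powr G b"
      by simp
  qed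
qed

text \<open>Holder's inequality applied to \<open>f = (f / h\<^sup>b) * h\<^sup>b\<close> with \<open>b = (r - 1) / r\<close>; unlike the duality proof,
  this does not need the left-hand side to be finite.\<close>
lemma (in pair_sigma_finite) nn_integral_Minkowski:
  assumes [measurable]: "f \<in> borel_measurable (M1 \<Otimes>\<^sub>M M2)" and r: "1 < r"
  shows "(\<integral>\<^sup>+s. enn_powr (\<integral>\<^sup>+z. f (z, s) \<partial>M1) r \<partial>M2)
    \<le> enn_powr (\<integral>\<^sup>+z. enn_powr (\<integral>\<^sup>+s. enn_powr (f (z, s)) r \<partial>M2) (1 / r) \<partial>M1) r"
proof -
  define h where "h z = enn_powr (\<integral>\<^sup>+s. enn_powr (f (z, s)) r \<partial>M2) (1 / r)" for z
  have h_meas [measurable]: "h \<in> borel_measurable M1"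
    unfolding h_def by measurable
  have hr: "(\<integral>\<^sup>+s. enn_powr (f (z, s)) r \<partial>M2) = enn_powr (h z) r" for z
    using r by (simp add: h_def)
  define H where "H = (\<integral>\<^sup>+z. h z \<partial>M1)"
  define b where "b = (r - 1) / r"
  have b: "0 < b" "1 / r + b = 1" "b * r = r - 1"
    using r by (auto simp: b_def field_simps)
  define k where "k z s = enn_powr (f (z, s) / enn_powr (h z) b) r" for z s
  show ?thesis
  proof (cases "H = top")
    case True
    then show ?thesis
      unfolding H_def h_def by simp
  next
    case False
    have k_le: "(\<integral>\<^sup>+s. k z s \<partial>M2) \<le> h z" if "z \<in> space M1" for z
    proof -
      have "(\<integral>\<^sup>+s. k z s \<partial>M2) = (\<integral>\<^sup>+s. enn_powr (f (z, s)) r \<partial>M2) / enn_powr (enn_powr (h z) b) r"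
        using r that by (simp add: k_def enn_powr_divide nn_integral_divide)
      also have "\<dots> = enn_powr (h z) r / enn_powr (h z) (r - 1)"
        by (simp add: hr enn_powr_powr b)
      also have "enn_powr (h z) r = enn_powr (h z) 1 * enn_powr (h z) (r - 1)"
        by (subst enn_powr_add[symmetric]) simp
      \<comment> \<open>Only an inequality: for h z = top the quotient top / top is 0.\<close>
      also have "enn_powr (h z) 1 * enn_powr (h z) (r - 1) / enn_powr (h z) (r - 1) \<le> h z"
        by (cases "h z = 0 \<or> h z = top") (auto simp: mult_divide_eq_ennreal)
      finally show ?thesis .
    qed
    \<comment> \<open>Where h z = top, dividing by its power kills \<open>k z s\<close> and the
      factorization of f is lost; finiteness of H confines this to a null set.\<close>
    have "AE z in M1. h z \<noteq> top"
      using nn_integral_noteq_infinite[OF h_meas] False by (simp add: H_def)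
    moreover have "AE z in M1. z \<in> space M1"
      by (rule AE_space)
    ultimately have "AE z in M1. AE s in M2. f (z, s) \<le> enn_powr (k z s) (1 / r) * enn_powr (h z) b"
    proof eventually_elim
      case (elim z)
      show ?case
      proof (cases "h z = 0")
        case True
        then have "(\<integral>\<^sup>+s. enn_powr (f (z, s)) r \<partial>M2) = 0"
          by (simp add: hr)
        then have "AE s in M2. f (z, s) = 0"
          using elim by (subst (asm) nn_integral_0_iff_AE) auto
        then show ?thesis
          by eventually_elim simp
      next
        case False
        then show ?thesis
          using elim r top.not_eq_extremum[of "h z"] by (simp add: k_def ennreal_divide_times)
      qed
    qed
    \<comment> \<open>Holder is applied in z for a fixed s, so the exceptional set has to be sliced
      the other way round.\<close>
    then have "AE s in M2. AE z in M1. f (z, s) \<le> enn_powr (k z s) (1 / r) * enn_powr (h z) b"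
      by (subst (asm) AE_commute) (auto simp: k_def)
    moreover have "AE s in M2. s \<in> space M2"
      by (rule AE_space)
    ultimately have "AE s in M2. enn_powr (\<integral>\<^sup>+z. f (z, s) \<partial>M1) r
        \<le> (\<integral>\<^sup>+z. k z s \<partial>M1) * enn_powr H (r - 1)"
    proof eventually_elim
      case (elim s)
      have [measurable]: "(\<lambda>z. k z s) \<in> borel_measurable M1"
        using elim unfolding k_def by measurable
      have "(\<integral>\<^sup>+z. f (z, s) \<partial>M1) \<le> (\<integral>\<^sup>+z. enn_powr (k z s) (1 / r) * enn_powr (h z) b \<partial>M1)"
        using elim by (intro nn_integral_mono_AE) auto
      also have "\<dots> \<le> enn_powr (\<integral>\<^sup>+z. k z s \<partial>M1) (1 / r) * enn_powr H b"
        unfolding H_def using r b by (intro nn_integral_Holder) auto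
      finally have "enn_powr (\<integral>\<^sup>+z. f (z, s) \<partial>M1) r
          \<le> enn_powr (enn_powr (\<integral>\<^sup>+z. k z s \<partial>M1) (1 / r) * enn_powr H b) r"
        using r by (intro enn_powr_mono) auto
      then show ?case
        using r by (simp add: enn_powr_mult enn_powr_powr b)
    qed
    then have "(\<integral>\<^sup>+s. enn_powr (\<integral>\<^sup>+z. f (z, s) \<partial>M1) r \<partial>M2)
        \<le> (\<integral>\<^sup>+s. (\<integral>\<^sup>+z. k z s \<partial>M1) * enn_powr H (r - 1) \<partial>M2)"
      by (rule nn_integral_mono_AE)
    also have "\<dots> = (\<integral>\<^sup>+s. (\<integral>\<^sup>+z. k z s \<partial>M1) \<partial>M2) * enn_powr H (r - 1)"
      by (intro nn_integral_multc) (simp add: k_def)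
    also have "(\<integral>\<^sup>+s. (\<integral>\<^sup>+z. k z s \<partial>M1) \<partial>M2) = (\<integral>\<^sup>+z. (\<integral>\<^sup>+s. k z s \<partial>M2) \<partial>M1)"
      by (intro Fubini') (simp add: k_def)
    also have "\<dots> \<le> H"
      unfolding H_def by (intro nn_integral_mono k_le)
    also have "H * enn_powr H (r - 1) = enn_powr H r"
      using enn_powr_add[of H 1 "r - 1"] by simp
    finally show ?thesis
      unfolding H_def h_def by (simp add: mult_right_mono)
  qed
qed

section \<open>Layer-cake formula\<close>

lemma nn_integral_powr_from_0:
  assumes "0 < p"
  shows "(\<integral>\<^sup>+l. ennreal (p * l powr (p - 1)) * indicator {l. 0 < l \<and> ennreal l < y} l \<partial>lborel) = enn_powr y p"
proof -
  have fin: "(\<integral>\<^sup>+l. ennreal (p * l powr (p - 1)) * indicator {0<..<a} l \<partial>lborel) = ennreal (a powr p)"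
    if "0 \<le> a" for a
  proof -
    have "((\<lambda>l. p * l powr (p - 1)) has_integral p * (a powr (p - 1 + 1) / (p - 1 + 1))) {0..a}"
      using assms that by (intro has_integral_mult_right has_integral_powr_from_0) auto
    then have I: "((\<lambda>l. p * l powr (p - 1)) has_integral a powr p) {0..a}"
      using assms by simp
    have "(\<integral>\<^sup>+l. ennreal (p * l powr (p - 1)) * indicator {0<..<a} l \<partial>lborel)
      = (\<integral>\<^sup>+l. ennreal (p * l powr (p - 1)) * indicator {0..a} l \<partial>lborel)"
    proof (rule nn_integral_cong_AE)
      have "AE l in lborel. l \<noteq> 0 \<and> l \<noteq> a"
        using AE_lborel_singleton[of 0] AE_lborel_singleton[of a] by eventually_elim auto
      then show "AE l in lborel. ennreal (p * l powr (p - 1)) * indicator {0<..<a} l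
          = ennreal (p * l powr (p - 1)) * indicator {0..a} l"
        by eventually_elim (auto split: split_indicator)
    qed
    also have "\<dots> = ennreal (a powr p)"
      using assms by (intro nn_integral_has_integral_lebesgue' I) auto
    finally show ?thesis .
  qed
  show ?thesis
  proof (cases "y = top")
    case False
    then obtain a where a: "y = ennreal a" "0 \<le> a"
      by (metis ennreal_cases)
    then have "{l. 0 < l \<and> ennreal l < y} = {0<..<a}"
      by (auto simp: ennreal_less_iff)
    then show ?thesis
      using fin a by (simp add: enn_powr_ennreal)
  next
    case True
    \<comment> \<open>For y = top, cutting the integral off at n^(1/p) gives exactly n.\<close>
    have "ennreal (real n) \<le> (\<integral>\<^sup>+l. ennreal (p * l powr (p - 1)) * indicator {l. 0 < l \<and> ennreal l < y} l \<partial>lborel)"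
      for n
    proof -
      have "ennreal (real n) = ennreal ((real n powr (1 / p)) powr p)"
        using assms by (simp add: powr_powr)
      also have "\<dots> = (\<integral>\<^sup>+l. ennreal (p * l powr (p - 1)) * indicator {0<..<real n powr (1 / p)} l \<partial>lborel)"
        by (rule fin[symmetric]) simp
      also have "\<dots> \<le> (\<integral>\<^sup>+l. ennreal (p * l powr (p - 1)) * indicator {l. 0 < l \<and> ennreal l < y} l \<partial>lborel)"
        by (intro nn_integral_mono) (auto split: split_indicator simp: True)
      finally show ?thesis .
    qed
    then have "top \<le> (\<integral>\<^sup>+l. ennreal (p * l powr (p - 1)) * indicator {l. 0 < l \<and> ennreal l < y} l \<partial>lborel)"
      unfolding ennreal_SUP_of_nat_eq_top[symmetric]
      by (intro SUP_least) (simp add: ennreal_of_nat_eq_real_of_nat)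
    with True show ?thesis
      by (simp add: top_unique)
  qed
qed

lemma nn_integral_powr_to_inf:
  assumes "0 < p" "0 < a"
  shows "(\<integral>\<^sup>+l. ennreal (l powr (- p - 1)) * indicator {a..} l \<partial>lborel) = ennreal (a powr (- p) / p)"
proof (rule nn_integral_has_integral_lebesgue')
  have "((\<lambda>l. l powr (- p - 1)) has_integral - (a powr (- p - 1 + 1)) / (- p - 1 + 1)) {a..}"
    using assms by (intro has_integral_powr_to_inf) auto
  then show "((\<lambda>l. l powr (- p - 1)) has_integral a powr (- p) / p) {a..}"
    by simp
qed auto

text \<open>Tonelli, after writing g(x)^p as the integral of p l^(p-1) over 0 < l < g(x). In the
  maximal inequality w serves once as the given weight and once as the product f * Mw.\<close>

lemma (in sigma_finite_measure) nn_integral_enn_powr_layer_cake: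
  assumes [measurable]: "g \<in> borel_measurable M" "w \<in> borel_measurable M" and p: "0 < p"
  shows "(\<integral>\<^sup>+x. enn_powr (g x) p * w x \<partial>M)
    = (\<integral>\<^sup>+l. ennreal (p * l powr (p - 1)) * indicator {0<..} l
         * (\<integral>\<^sup>+x. w x * indicator {x. ennreal l < g x} x \<partial>M) \<partial>lborel)"
proof -
  interpret pair_sigma_finite M lborel ..
  have "(\<integral>\<^sup>+x. enn_powr (g x) p * w x \<partial>M)
    = (\<integral>\<^sup>+x. \<integral>\<^sup>+l. ennreal (p * l powr (p - 1)) * indicator {l. 0 < l \<and> ennreal l < g x} l * w x \<partial>lborel \<partial>M)"
    using p by (simp add: nn_integral_powr_from_0 nn_integral_multc)
  also have "\<dots> = (\<integral>\<^sup>+l. \<integral>\<^sup>+x. ennreal (p * l powr (p - 1)) * indicator {l. 0 < l \<and> ennreal l < g x} l * w x \<partial>M \<partial>lborel)"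
    by (intro Fubini'[symmetric]) measurable
  also have "\<dots> = (\<integral>\<^sup>+l. ennreal (p * l powr (p - 1)) * indicator {0<..} l
         * (\<integral>\<^sup>+x. w x * indicator {x. ennreal l < g x} x \<partial>M) \<partial>lborel)"
  proof (intro nn_integral_cong)
    fix l
    have "(\<integral>\<^sup>+x. ennreal (p * l powr (p - 1)) * indicator {l. 0 < l \<and> ennreal l < g x} l * w x \<partial>M)
      = (\<integral>\<^sup>+x. (ennreal (p * l powr (p - 1)) * indicator {0<..} l) * (w x * indicator {x. ennreal l < g x} x) \<partial>M)"
      by (intro nn_integral_cong) (auto split: split_indicator)
    then show "(\<integral>\<^sup>+x. ennreal (p * l powr (p - 1)) * indicator {l. 0 < l \<and> ennreal l < g x} l * w x \<partial>M)
      = ennreal (p * l powr (p - 1)) * indicator {0<..} l * (\<integral>\<^sup>+x. w x * indicator {x. ennreal l < g x} x \<partial>M)"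
      by (simp add: nn_integral_cmult)
  qed
  finally show ?thesis .
qed

section \<open>The Hardy-Littlewood maximal operator\<close>

lemma emeasure_ball_pos_finite:
  fixes x :: "'a::euclidean_space"
  assumes "0 < t"
  shows "emeasure lborel (ball x t) \<noteq> 0" "emeasure lborel (ball x t) \<noteq> top" "emeasure lborel (ball x t) < top"
  using assms unit_ball_vol_pos[of "real DIM('a)"] by (auto simp: emeasure_ball simp del: unit_ball_vol_pos)

lemma ball_in_sets_borel [measurable]: "ball (x :: 'a::metric_space) t \<in> sets borel"
  by simp

lemma emeasure_ball_scale:
  fixes x y :: "'a::euclidean_space"
  assumes "0 \<le> t" "0 \<le> c"
  shows "emeasure lborel (ball y (c * t)) = ennreal (c ^ DIM('a)) * emeasure lborel (ball x t)"
proof -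
  have "emeasure lborel (ball y (c * t)) = ennreal (c ^ DIM('a) * (unit_ball_vol (DIM('a)) * t ^ DIM('a)))"
    using assms by (simp add: emeasure_ball power_mult_distrib ac_simps)
  also have "\<dots> = ennreal (c ^ DIM('a)) * emeasure lborel (ball x t)"
    using assms by (subst ennreal_mult) (auto simp: emeasure_ball)
  finally show ?thesis .
qed

text \<open>Fatou's lemma along a convergent sequence of points: openness of the sets of x with z
  \<in> K x makes the indicator lower semicontinuous in x. Applied to balls of fixed radius and to
  the cones of the area functional.\<close>

lemma open_superlevel_nn_integral:
  fixes K :: "'a::first_countable_topology \<Rightarrow> 'b set"
  assumes [measurable]: "f \<in> borel_measurable M" "\<And>x. K x \<in> sets M"
    and K: "\<And>z. open {x. z \<in> K x}"
  shows "open {x. c < (\<integral>\<^sup>+z. f z * indicator (K x) z \<partial>M)}"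
proof -
  have "closed {x. (\<integral>\<^sup>+z. f z * indicator (K x) z \<partial>M) \<le> c}"
    unfolding closed_sequential_limits
  proof (intro allI impI, elim conjE)
    fix X l assume X: "\<forall>n. X n \<in> {x. (\<integral>\<^sup>+z. f z * indicator (K x) z \<partial>M) \<le> c}" "X \<longlonglongrightarrow> l"
    have "f z * indicator (K l) z \<le> liminf (\<lambda>n. f z * indicator (K (X n)) z)" for z
    proof (cases "z \<in> K l")
      case True
      have "eventually (\<lambda>n. X n \<in> {x. z \<in> K x}) sequentially"
        using X(2) K[of z] True by (intro topological_tendstoD) auto
      then have "eventually (\<lambda>n. f z * indicator (K l) z \<le> f z * indicator (K (X n)) z) sequentially"
        by eventually_elim (use True in auto)
      then show ?thesis
        by (rule Liminf_bounded)
    qed auto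
    then have "(\<integral>\<^sup>+z. f z * indicator (K l) z \<partial>M) \<le> (\<integral>\<^sup>+z. liminf (\<lambda>n. f z * indicator (K (X n)) z) \<partial>M)"
      by (intro nn_integral_mono)
    also have "\<dots> \<le> liminf (\<lambda>n. \<integral>\<^sup>+z. f z * indicator (K (X n)) z \<partial>M)"
      by (intro nn_integral_liminf) measurable
    also have "\<dots> \<le> c"
      using X(1) by (intro Liminf_le) auto
    finally show "l \<in> {x. (\<integral>\<^sup>+z. f z * indicator (K x) z \<partial>M) \<le> c}"
      by simp
  qed
  moreover have "{x. c < (\<integral>\<^sup>+z. f z * indicator (K x) z \<partial>M)} = - {x. (\<integral>\<^sup>+z. f z * indicator (K x) z \<partial>M) \<le> c}"
    by (auto simp: not_le)
  ultimately show ?thesis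
    by (simp add: open_Compl)
qed

lemma open_in_center_ball: "open {x. z \<in> ball x t}"
proof -
  have "{x. z \<in> ball x t} = ball z t"
    by (auto simp: dist_commute)
  then show ?thesis
    by simp
qed

text \<open>Arguments and values in \<open>ennreal\<close> let one operator act on fibre norms,
  weights and Whitney averages alike, without finiteness conditions.\<close>

definition hl_max :: "('a::euclidean_space \<Rightarrow> ennreal) \<Rightarrow> 'a \<Rightarrow> ennreal" where
  "hl_max f x = (SUP t\<in>{0<..}. (\<integral>\<^sup>+y. f y * indicator (ball x t) y \<partial>lborel) / emeasure lborel (ball x t))"

lemma ennreal_divide_le_iff:
  fixes a b c :: ennreal
  assumes "b \<noteq> 0" "b \<noteq> top"
  shows "a / b \<le> c \<longleftrightarrow> a \<le> b * c"
proof -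
  have "a / b \<le> c \<longleftrightarrow> b * (a / b) \<le> b * c"
    using assms by (simp add: ennreal_mult_le_mult_iff)
  also have "b * (a / b) = a"
    using assms by (simp add: ennreal_times_divide mult.commute[of b] mult_divide_eq_ennreal)
  finally show ?thesis .
qed

lemma hl_max_le_iff:
  "hl_max f x \<le> c \<longleftrightarrow>
    (\<forall>t>0. (\<integral>\<^sup>+y. f y * indicator (ball x t) y \<partial>lborel) \<le> emeasure lborel (ball x t) * c)"
  unfolding hl_max_def by (auto simp: SUP_le_iff ennreal_divide_le_iff emeasure_ball_pos_finite)

lemma nn_integral_ball_le_hl_max:
  "(\<integral>\<^sup>+y. f y * indicator (ball x t) y \<partial>lborel) \<le> emeasure lborel (ball x t) * hl_max f x"
  using hl_max_le_iff[of f x "hl_max f x"] by (cases "0 < t") (auto simp: not_less ball_empty)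

lemma less_hl_max_iff:
  "c < hl_max f x \<longleftrightarrow>
    (\<exists>t>0. emeasure lborel (ball x t) * c < (\<integral>\<^sup>+y. f y * indicator (ball x t) y \<partial>lborel))"
  using hl_max_le_iff[of f x c] by (meson not_le)

lemma hl_max_mono_AE:
  assumes "AE y in lborel. f y \<le> g y"
  shows "hl_max f x \<le> hl_max g x"
  unfolding hl_max_def
proof (intro SUP_mono' divide_right_mono_ennreal nn_integral_mono_AE)
  fix t
  show "AE y in lborel. f y * indicator (ball x t) y \<le> g y * indicator (ball x t) y"
    using assms by eventually_elim (auto intro: mult_right_mono)
qed

lemma hl_max_mono: "(\<And>y. f y \<le> g y) \<Longrightarrow> hl_max f x \<le> hl_max g x"
  by (intro hl_max_mono_AE) auto

lemma hl_max_cong_AE: "AE y in lborel. f y = g y \<Longrightarrow> hl_max f x = hl_max g x"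
  by (intro antisym hl_max_mono_AE) auto

lemma hl_max_const [simp]: "hl_max (\<lambda>y. c) x = c"
proof -
  have "(\<integral>\<^sup>+y. c * indicator (ball x t) y \<partial>lborel) / emeasure lborel (ball x t) = c" if "0 < t" for t
    using emeasure_ball_pos_finite[OF that, of x]
    by (simp add: nn_integral_cmult_indicator mult_divide_eq_ennreal)
  then show ?thesis
    unfolding hl_max_def by simp
qed

lemma hl_max_add_le:
  assumes [measurable]: "f \<in> borel_measurable borel" "g \<in> borel_measurable borel"
  shows "hl_max (\<lambda>y. f y + g y) x \<le> hl_max f x + hl_max g x"
  unfolding hl_max_le_iff
proof (intro allI impI)
  fix t
  have "(\<integral>\<^sup>+y. (f y + g y) * indicator (ball x t) y \<partial>lborel)
    = (\<integral>\<^sup>+y. f y * indicator (ball x t) y \<partial>lborel) + (\<integral>\<^sup>+y. g y * indicator (ball x t) y \<partial>lborel)"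
    unfolding distrib_right by (intro nn_integral_add) measurable
  then show "(\<integral>\<^sup>+y. (f y + g y) * indicator (ball x t) y \<partial>lborel)
    \<le> emeasure lborel (ball x t) * (hl_max f x + hl_max g x)"
    by (simp add: distrib_left add_mono nn_integral_ball_le_hl_max)
qed

section \<open>Semicontinuity and measurability of the maximal function\<close>

lemma open_superlevel_ball_average:
  fixes f :: "'a::euclidean_space \<Rightarrow> ennreal"
  assumes [measurable]: "f \<in> borel_measurable borel"
  shows "open {x. emeasure lborel (ball x t) * c < (\<integral>\<^sup>+y. f y * indicator (ball x t) y \<partial>lborel)}"
proof (cases "0 \<le> t")
  case True
  \<comment> \<open>The volume of a ball does not depend on its centre, so the threshold is constant
    in x.\<close>
  then have eq: "emeasure lborel (ball x t) * c = emeasure lborel (ball (0::'a) t) * c" for x :: 'a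
    by (simp add: emeasure_ball)
  have "{x. emeasure lborel (ball x t) * c < (\<integral>\<^sup>+y. f y * indicator (ball x t) y \<partial>lborel)}
      = {x. emeasure lborel (ball (0::'a) t) * c < (\<integral>\<^sup>+y. f y * indicator (ball x t) y \<partial>lborel)}"
    by (intro Collect_cong) (subst eq, rule refl)
  moreover have "open {x. emeasure lborel (ball (0::'a) t) * c < (\<integral>\<^sup>+y. f y * indicator (ball x t) y \<partial>lborel)}"
    by (intro open_superlevel_nn_integral open_in_center_ball) simp_all
  ultimately show ?thesis
    by simp
qed (simp add: ball_empty)

lemma hl_max_superlevel_eq:
  "{x. c < hl_max f x}
    = (\<Union>t\<in>{0<..}. {x. emeasure lborel (ball x t) * c < (\<integral>\<^sup>+y. f y * indicator (ball x t) y \<partial>lborel)})"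
  by (auto simp: less_hl_max_iff)

lemma open_superlevel_hl_max:
  assumes "f \<in> borel_measurable borel"
  shows "open {x. c < hl_max f x}"
  unfolding hl_max_superlevel_eq using assms by (intro open_UN ballI open_superlevel_ball_average)

text \<open>Open superlevel sets give measurability in x alone; joint measurability in x and a
  parameter comes from a countable supremum. Rational radii tending to t from below suffice: Fatou
  recovers the integral over the open ball, and the smaller balls have no larger volume.\<close>

lemma hl_max_eq_SUP_rat:
  assumes [measurable]: "f \<in> borel_measurable borel"
  shows "hl_max f x
    = (SUP t\<in>{t\<in>\<rat>. 0 < t}. (\<integral>\<^sup>+y. f y * indicator (ball x t) y \<partial>lborel) / emeasure lborel (ball x t))"
proof (rule antisym)
  define S where "S = (SUP t\<in>{t\<in>\<rat>. 0 < t}. (\<integral>\<^sup>+y. f y * indicator (ball x t) y \<partial>lborel) / emeasure lborel (ball x t))"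
  show "hl_max f x \<le> S"
    unfolding hl_max_le_iff
  proof (intro allI impI)
    fix t :: real assume t: "0 < t"
    have "\<exists>q\<in>\<rat>. max 0 (t - inverse (Suc n)) < q \<and> q < t" for n
      using t by (intro Rats_dense_in_real) (simp del: of_nat_Suc)
    then obtain q where q: "\<And>n. q n \<in> \<rat>" "\<And>n. max 0 (t - inverse (Suc n)) < q n" "\<And>n. q n < t"
      by metis
    have "(\<integral>\<^sup>+y. f y * indicator (ball x t) y \<partial>lborel)
        \<le> (\<integral>\<^sup>+y. liminf (\<lambda>n. f y * indicator (ball x (q n)) y) \<partial>lborel)"
    proof (intro nn_integral_mono)
      fix y
      show "f y * indicator (ball x t) y \<le> liminf (\<lambda>n. f y * indicator (ball x (q n)) y)"
      proof (cases "y \<in> ball x t")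
        case True
        have "eventually (\<lambda>n. inverse (real (Suc n)) < t - dist x y) sequentially"
          using True by (intro order_tendstoD(2)[OF LIMSEQ_inverse_real_of_nat]) auto
        then have "eventually (\<lambda>n. f y * indicator (ball x t) y \<le> f y * indicator (ball x (q n)) y) sequentially"
        proof eventually_elim
          case (elim n)
          have "t - inverse (real (Suc n)) < q n"
            using q(2)[of n] by (simp del: of_nat_Suc)
          with elim have "y \<in> ball x (q n)"
            by (simp del: of_nat_Suc)
          then show ?case
            by (simp add: indicator_def)
        qed
        then show ?thesis
          by (rule Liminf_bounded)
      qed auto
    qed
    also have "\<dots> \<le> liminf (\<lambda>n. \<integral>\<^sup>+y. f y * indicator (ball x (q n)) y \<partial>lborel)"
      by (intro nn_integral_liminf) measurable
    also have "\<dots> \<le> emeasure lborel (ball x t) * S"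
    proof (intro Liminf_le always_eventually allI)
      fix n
      have qn: "0 < q n"
        using q(2)[of n] by simp
      then have "(\<integral>\<^sup>+y. f y * indicator (ball x (q n)) y \<partial>lborel) / emeasure lborel (ball x (q n)) \<le> S"
        unfolding S_def using q(1) by (intro SUP_upper) auto
      then have "(\<integral>\<^sup>+y. f y * indicator (ball x (q n)) y \<partial>lborel) \<le> emeasure lborel (ball x (q n)) * S"
        using qn by (simp add: ennreal_divide_le_iff emeasure_ball_pos_finite)
      also have "\<dots> \<le> emeasure lborel (ball x t) * S"
        using q(3)[of n] by (intro mult_right_mono emeasure_mono) auto
      finally show "(\<integral>\<^sup>+y. f y * indicator (ball x (q n)) y \<partial>lborel) \<le> emeasure lborel (ball x t) * S" .
    qed auto
    finally show "(\<integral>\<^sup>+y. f y * indicator (ball x t) y \<partial>lborel) \<le> emeasure lborel (ball x t) * S" .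
  qed
  show "S \<le> hl_max f x"
    unfolding hl_max_def S_def by (intro SUP_subset_mono) auto
qed

lemma borel_measurable_hl_max_pair:
  fixes f :: "'a::euclidean_space \<times> 'b \<Rightarrow> ennreal"
  assumes [measurable]: "f \<in> borel_measurable (lborel \<Otimes>\<^sub>M N)"
  shows "(\<lambda>z. hl_max (\<lambda>y. f (y, snd z)) (fst z)) \<in> borel_measurable (lborel \<Otimes>\<^sub>M N)"
proof -
  have eq: "hl_max (\<lambda>y. f (y, snd z)) (fst z)
    = (SUP t\<in>{t\<in>\<rat>. 0 < t}. (\<integral>\<^sup>+y. f (y, snd z) * indicator {y. dist (fst z) y < t} y \<partial>lborel)
          / ennreal (unit_ball_vol (DIM('a)) * t ^ DIM('a)))"
    if "z \<in> space (lborel \<Otimes>\<^sub>M N)" for z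
  proof -
    have [measurable]: "(\<lambda>y. f (y, snd z)) \<in> borel_measurable borel"
      using that by (auto simp: space_pair_measure)
    show ?thesis
      by (subst hl_max_eq_SUP_rat) (auto intro!: SUP_cong simp: emeasure_ball[unfolded ball_def] ball_def)
  qed
  have "countable {t\<in>\<rat>. 0 < (t::real)}"
    by (rule countable_subset[OF _ countable_rat]) auto
  then have "(\<lambda>z. SUP t\<in>{t\<in>\<rat>. 0 < t}. (\<integral>\<^sup>+y. f (y, snd z) * indicator {y. dist (fst z) y < t} y \<partial>lborel)
          / ennreal (unit_ball_vol (DIM('a)) * t ^ DIM('a))) \<in> borel_measurable (lborel \<Otimes>\<^sub>M N)"
    by (intro borel_measurable_SUP) measurable
  then show ?thesis
    by (subst measurable_cong[OF eq])
qed

lemma borel_measurable_hl_max [measurable]: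
  assumes [measurable]: "f \<in> borel_measurable borel"
  shows "hl_max f \<in> borel_measurable borel"
  using open_superlevel_hl_max[OF assms] by (intro borel_measurableI_greater) (auto simp: greaterThan_def)

text \<open>Vitali selects disjoint balls B with c |B| at most the integral of f over B, whose
  fivefold dilates cover the level set. The ratio w(5B) / |B| is at most 6^n Mw(y) at each y in B,
  so c w(5B) is at most 6^n times the integral of f Mw over B, and these integrals add up over
  disjoint balls.\<close>

lemma hl_max_weak_type_weighted:
  fixes f w :: "'a::euclidean_space \<Rightarrow> ennreal"
  assumes [measurable]: "f \<in> borel_measurable borel" "w \<in> borel_measurable borel"
  shows "c * (\<integral>\<^sup>+x. w x * indicator {x. c < hl_max f x} x \<partial>lborel)
    \<le> 6 ^ DIM('a) * (\<integral>\<^sup>+x. f x * hl_max w x \<partial>lborel)"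
proof -
  \<comment> \<open>Vitali's lemma requires bounded radii, so the level set is exhausted by the
    centres of balls of radius at most n.\<close>
  define E where "E n = (\<Union>t\<in>{0<..real n}. {x. emeasure lborel (ball x t) * c < (\<integral>\<^sup>+y. f y * indicator (ball x t) y \<partial>lborel)})"
    for n
  have "open (E n)" for n
    unfolding E_def by (intro open_UN ballI open_superlevel_ball_average assms)
  then have E_meas [measurable]: "E n \<in> sets borel" for n
    by simp
  have "incseq E"
    unfolding E_def by (intro incseq_SucI UN_mono) auto
  have E_UN: "{x. c < hl_max f x} = (\<Union>n. E n)"
  proof -
    have "\<exists>n. t \<le> real n" for t
      by (rule real_arch_simple)
    then show ?thesis
      unfolding hl_max_superlevel_eq E_def by fastforce
  qed
  have bound: "c * (\<integral>\<^sup>+x. w x * indicator (E n) x \<partial>lborel) \<le> 6 ^ DIM('a) * (\<integral>\<^sup>+x. f x * hl_max w x \<partial>lborel)" for n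
  proof -
    define K where "K = {(x, t). 0 < t \<and> t \<le> real n \<and>
      emeasure lborel (ball x t) * c < (\<integral>\<^sup>+y. f y * indicator (ball x t) y \<partial>lborel)}"
    have "E n \<subseteq> (\<Union>i\<in>K. ball (fst i) (snd i))"
      unfolding E_def K_def by force
    moreover have "0 < snd i \<and> snd i \<le> real n" if "i \<in> K" for i
      using that by (auto simp: K_def)
    ultimately obtain C where C: "countable C" "C \<subseteq> K"
      "pairwise (\<lambda>i j. disjnt (ball (fst i) (snd i)) (ball (fst j) (snd j))) C"
      "E n \<subseteq> (\<Union>i\<in>C. ball (fst i) (5 * snd i))"
      by (rule Vitali_covering_lemma_balls)
    have disj: "disjoint_family_on (\<lambda>i. ball (fst i) (snd i)) C"
      using C(3) by (auto simp: disjoint_family_on_def pairwise_def disjnt_def)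
    have ball_bound: "c * (\<integral>\<^sup>+x. w x * indicator (ball (fst i) (5 * snd i)) x \<partial>lborel)
        \<le> 6 ^ DIM('a) * (\<integral>\<^sup>+x. f x * hl_max w x * indicator (ball (fst i) (snd i)) x \<partial>lborel)" if "i \<in> C" for i
    proof -
      obtain a t where i: "i = (a, t)"
        by (cases i)
      define B where "B = emeasure lborel (ball a t)"
      define W where "W = (\<integral>\<^sup>+x. w x * indicator (ball a (5 * t)) x \<partial>lborel)"
      have t: "0 < t" "B * c \<le> (\<integral>\<^sup>+y. f y * indicator (ball a t) y \<partial>lborel)"
        using that C(2) by (auto simp: K_def i B_def)
      have W_le: "W \<le> 6 ^ DIM('a) * B * hl_max w y" if "y \<in> ball a t" for y
      proof -
        \<comment> \<open>Recentring at y costs one more radius, 5 + 1 = 6: the origin of the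
          constant.\<close>
        have "ball a (5 * t) \<subseteq> ball y (6 * t)"
          using that t by (intro ball_subset_ball_iff[THEN iffD2]) (auto simp: dist_commute)
        then have "W \<le> (\<integral>\<^sup>+x. w x * indicator (ball y (6 * t)) x \<partial>lborel)"
          unfolding W_def by (intro nn_integral_mono) (auto split: split_indicator)
        also have "\<dots> \<le> emeasure lborel (ball y (6 * t)) * hl_max w y"
          by (rule nn_integral_ball_le_hl_max)
        also have "emeasure lborel (ball y (6 * t)) = 6 ^ DIM('a) * B"
          unfolding B_def using t by (subst emeasure_ball_scale[of _ _ _ a]) (auto simp flip: ennreal_power)
        finally show ?thesis .
      qed
      have "B * (c * W) \<le> (\<integral>\<^sup>+y. f y * indicator (ball a t) y \<partial>lborel) * W"
        using t by (simp add: mult.assoc[symmetric] mult_right_mono)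
      also have "\<dots> = (\<integral>\<^sup>+y. f y * indicator (ball a t) y * W \<partial>lborel)"
        by (intro nn_integral_multc[symmetric]) measurable
      also have "\<dots> \<le> (\<integral>\<^sup>+y. (6 ^ DIM('a) * B) * (f y * hl_max w y * indicator (ball a t) y) \<partial>lborel)"
      proof (intro nn_integral_mono)
        fix y
        show "f y * indicator (ball a t) y * W \<le> (6 ^ DIM('a) * B) * (f y * hl_max w y * indicator (ball a t) y)"
        proof (cases "y \<in> ball a t")
          case True
          then show ?thesis
            using mult_left_mono[OF W_le[OF True], of "f y"] by (simp add: ac_simps)
        qed simp
      qed
      also have "\<dots> = B * (6 ^ DIM('a) * (\<integral>\<^sup>+y. f y * hl_max w y * indicator (ball a t) y \<partial>lborel))"
        by (subst nn_integral_cmult) (auto simp: ac_simps)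
      finally show ?thesis
        using emeasure_ball_pos_finite[OF t(1), of a] unfolding i W_def B_def
        by (simp add: ennreal_mult_le_mult_iff)
    qed
    have "(\<integral>\<^sup>+x. w x * indicator (E n) x \<partial>lborel)
      \<le> (\<integral>\<^sup>+x. \<integral>\<^sup>+i. w x * indicator (ball (fst i) (5 * snd i)) x \<partial>count_space C \<partial>lborel)"
    proof (intro nn_integral_mono)
      fix x
      show "w x * indicator (E n) x \<le> (\<integral>\<^sup>+i. w x * indicator (ball (fst i) (5 * snd i)) x \<partial>count_space C)"
      proof (cases "x \<in> E n")
        case True
        then obtain i where "i \<in> C" "x \<in> ball (fst i) (5 * snd i)"
          using C(4) by blast
        then show ?thesis
          using True nn_integral_ge_point[of i C "\<lambda>i. w x * indicator (ball (fst i) (5 * snd i)) x"] by simp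
      qed simp
    qed
    also have "\<dots> = (\<integral>\<^sup>+i. \<integral>\<^sup>+x. w x * indicator (ball (fst i) (5 * snd i)) x \<partial>lborel \<partial>count_space C)"
      using C(1) by (intro nn_integral_count_space_nn_integral) auto
    finally have "c * (\<integral>\<^sup>+x. w x * indicator (E n) x \<partial>lborel)
      \<le> c * (\<integral>\<^sup>+i. \<integral>\<^sup>+x. w x * indicator (ball (fst i) (5 * snd i)) x \<partial>lborel \<partial>count_space C)"
      by (rule mult_left_mono) simp
    also have "\<dots> = (\<integral>\<^sup>+i. c * (\<integral>\<^sup>+x. w x * indicator (ball (fst i) (5 * snd i)) x \<partial>lborel) \<partial>count_space C)"
      by (simp add: nn_integral_cmult)
    also have "\<dots> \<le> (\<integral>\<^sup>+i. 6 ^ DIM('a) * (\<integral>\<^sup>+x. f x * hl_max w x * indicator (ball (fst i) (snd i)) x \<partial>lborel) \<partial>count_space C)"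
      by (intro nn_integral_mono ball_bound) auto
    \<comment> \<open>Passing to the measure with density f * Mw turns the sum over disjoint balls
      into the measure of their union.\<close>
    also have "\<dots> = 6 ^ DIM('a) * (\<integral>\<^sup>+i. emeasure (density lborel (\<lambda>x. f x * hl_max w x)) (ball (fst i) (snd i)) \<partial>count_space C)"
      by (simp add: nn_integral_cmult emeasure_density)
    also have "(\<integral>\<^sup>+i. emeasure (density lborel (\<lambda>x. f x * hl_max w x)) (ball (fst i) (snd i)) \<partial>count_space C)
        = emeasure (density lborel (\<lambda>x. f x * hl_max w x)) (\<Union>i\<in>C. ball (fst i) (snd i))"
      using C(1) disj by (intro emeasure_UN_countable[symmetric]) auto
    also have "\<dots> \<le> emeasure (density lborel (\<lambda>x. f x * hl_max w x)) UNIV"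
      by (intro emeasure_mono) auto
    also have "\<dots> = (\<integral>\<^sup>+x. f x * hl_max w x \<partial>lborel)"
      by (subst emeasure_density) auto
    finally show ?thesis
      by (simp add: mult_left_mono)
  qed
  have "(\<integral>\<^sup>+x. w x * indicator {x. c < hl_max f x} x \<partial>lborel) = emeasure (density lborel w) (\<Union>n. E n)"
    unfolding E_UN by (subst emeasure_density) auto
  also have "\<dots> = (SUP n. emeasure (density lborel w) (E n))"
    using \<open>incseq E\<close> by (intro SUP_emeasure_incseq[symmetric]) auto
  also have "\<dots> = (SUP n. \<integral>\<^sup>+x. w x * indicator (E n) x \<partial>lborel)"
    by (simp add: emeasure_density)
  finally show ?thesis
    using bound by (simp add: SUP_mult_left_ennreal SUP_le_iff)
qed

lemma hl_max_weak_type: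
  fixes f :: "'a::euclidean_space \<Rightarrow> ennreal"
  assumes [measurable]: "f \<in> borel_measurable borel"
  shows "c * emeasure lborel {x. c < hl_max f x} \<le> 6 ^ DIM('a) * (\<integral>\<^sup>+x. f x \<partial>lborel)"
proof -
  have [measurable]: "{x. c < hl_max f x} \<in> sets lborel"
    using open_superlevel_hl_max[OF assms] by simp
  show ?thesis
    using hl_max_weak_type_weighted[OF assms, of "\<lambda>_. 1" c] by simp
qed

text \<open>Marcinkiewicz interpolation: at each level l the weak type is applied to the part of f
  above l / 2. A second layer cake, with exponent p - 1, function 2 f and weight f * Mw, reassembles
  f^p Mw.\<close>

lemma hl_max_strong_type_weighted:
  assumes p: "1 < p"
  shows "\<exists>C<top. \<forall>f w :: 'a::euclidean_space \<Rightarrow> ennreal.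
    f \<in> borel_measurable borel \<longrightarrow> w \<in> borel_measurable borel \<longrightarrow>
      (\<integral>\<^sup>+x. enn_powr (hl_max f x) p * w x \<partial>lborel) \<le> C * (\<integral>\<^sup>+x. enn_powr (f x) p * hl_max w x \<partial>lborel)"
proof -
  \<comment> \<open>The 2 comes from the half height l / 2; p / (p - 1) converts the kernel p
    l^(p-2) into the layer-cake kernel of exponent p - 1.\<close>
  define D where "D = ennreal (2 * p / (p - 1)) * 6 ^ DIM('a)"
  have "(\<integral>\<^sup>+x. enn_powr (hl_max f x) p * w x \<partial>lborel)
      \<le> (D * enn_powr 2 (p - 1)) * (\<integral>\<^sup>+x. enn_powr (f x) p * hl_max w x \<partial>lborel)"
    if [measurable]: "f \<in> borel_measurable borel" "w \<in> borel_measurable borel"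
    for f w :: "'a \<Rightarrow> ennreal"
  proof -
    have level: "ennreal l * (\<integral>\<^sup>+x. w x * indicator {x. ennreal l < hl_max f x} x \<partial>lborel)
        \<le> 2 * (6 ^ DIM('a) * (\<integral>\<^sup>+x. f x * hl_max w x * indicator {x. ennreal l < 2 * f x} x \<partial>lborel))"
      if "0 < l" for l
    proof -
      \<comment> \<open>The part of f below l / 2 adds at most l / 2 to the maximal function, so Mf
        > l forces Mg > l / 2.\<close>
      define g where "g x = f x * indicator {x. ennreal l < 2 * f x} x" for x
      have [measurable]: "g \<in> borel_measurable borel"
        unfolding g_def by measurable
      have half: "ennreal l = ennreal (l / 2) + ennreal (l / 2)" "ennreal l = 2 * ennreal (l / 2)"
        using that by (simp_all flip: ennreal_plus ennreal_mult'' ennreal_numeral)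
      have "f x \<le> g x + ennreal (l / 2)" for x
      proof (cases "ennreal l < 2 * f x")
        case False
        then have "f x \<le> ennreal (l / 2)"
          using half(2) ennreal_mult_le_mult_iff[of 2 "f x" "ennreal (l / 2)"] by (simp add: not_less)
        then show ?thesis
          by (simp add: add_increasing)
      qed (simp add: g_def)
      then have "hl_max f x \<le> hl_max (\<lambda>x. g x + ennreal (l / 2)) x" for x
        by (rule hl_max_mono)
      also have "\<dots> x \<le> hl_max g x + ennreal (l / 2)" for x
        using hl_max_add_le[of g "\<lambda>_. ennreal (l / 2)" x] by simp
      finally have split: "hl_max f x \<le> hl_max g x + ennreal (l / 2)" for x .
      have "{x. ennreal l < hl_max f x} \<subseteq> {x. ennreal (l / 2) < hl_max g x}"
      proof (safe, rule ccontr)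
        fix x assume "ennreal l < hl_max f x" "\<not> ennreal (l / 2) < hl_max g x"
        moreover from this have "hl_max g x + ennreal (l / 2) \<le> ennreal l"
          unfolding half(1) by (intro add_mono) auto
        ultimately show False
          using split[of x] by simp
      qed
      then have "(\<integral>\<^sup>+x. w x * indicator {x. ennreal l < hl_max f x} x \<partial>lborel)
          \<le> (\<integral>\<^sup>+x. w x * indicator {x. ennreal (l / 2) < hl_max g x} x \<partial>lborel)"
        by (intro nn_integral_mono) (auto split: split_indicator)
      then have "ennreal l * (\<integral>\<^sup>+x. w x * indicator {x. ennreal l < hl_max f x} x \<partial>lborel)
          \<le> 2 * (ennreal (l / 2) * (\<integral>\<^sup>+x. w x * indicator {x. ennreal (l / 2) < hl_max g x} x \<partial>lborel))"
        unfolding half(2) by (simp add: mult.assoc mult_left_mono)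
      also have "\<dots> \<le> 2 * (6 ^ DIM('a) * (\<integral>\<^sup>+x. g x * hl_max w x \<partial>lborel))"
        by (intro mult_left_mono hl_max_weak_type_weighted) auto
      finally show ?thesis
        by (simp add: g_def ac_simps)
    qed
    have "(\<integral>\<^sup>+x. enn_powr (hl_max f x) p * w x \<partial>lborel)
      = (\<integral>\<^sup>+l. ennreal (p * l powr (p - 1)) * indicator {0<..} l
         * (\<integral>\<^sup>+x. w x * indicator {x. ennreal l < hl_max f x} x \<partial>lborel) \<partial>lborel)"
      using p by (intro lborel.nn_integral_enn_powr_layer_cake) auto
    also have "\<dots> \<le> (\<integral>\<^sup>+l. D * (ennreal ((p - 1) * l powr (p - 1 - 1)) * indicator {0<..} l
         * (\<integral>\<^sup>+x. f x * hl_max w x * indicator {x. ennreal l < 2 * f x} x \<partial>lborel)) \<partial>lborel)"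
    proof (intro nn_integral_mono)
      fix l :: real
      show "ennreal (p * l powr (p - 1)) * indicator {0<..} l
         * (\<integral>\<^sup>+x. w x * indicator {x. ennreal l < hl_max f x} x \<partial>lborel)
        \<le> D * (ennreal ((p - 1) * l powr (p - 1 - 1)) * indicator {0<..} l
         * (\<integral>\<^sup>+x. f x * hl_max w x * indicator {x. ennreal l < 2 * f x} x \<partial>lborel))"
      proof (cases "0 < l")
        case True
        have "ennreal (p * l powr (p - 1)) = ennreal (p * l powr (p - 1 - 1)) * ennreal l"
          using True p by (simp add: powr_diff power2_eq_square flip: ennreal_mult)
        then have "ennreal (p * l powr (p - 1)) * (\<integral>\<^sup>+x. w x * indicator {x. ennreal l < hl_max f x} x \<partial>lborel)
          = ennreal (p * l powr (p - 1 - 1)) * (ennreal l * (\<integral>\<^sup>+x. w x * indicator {x. ennreal l < hl_max f x} x \<partial>lborel))"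
          by (simp add: mult.assoc)
        also have "\<dots> \<le> ennreal (p * l powr (p - 1 - 1)) * (2 * (6 ^ DIM('a) *
            (\<integral>\<^sup>+x. f x * hl_max w x * indicator {x. ennreal l < 2 * f x} x \<partial>lborel)))"
          by (intro mult_left_mono level True) auto
        also have "ennreal (p * l powr (p - 1 - 1)) * (2 * (6 ^ DIM('a) *
            (\<integral>\<^sup>+x. f x * hl_max w x * indicator {x. ennreal l < 2 * f x} x \<partial>lborel)))
          = (ennreal (p * l powr (p - 1 - 1)) * 2) * (6 ^ DIM('a) *
            (\<integral>\<^sup>+x. f x * hl_max w x * indicator {x. ennreal l < 2 * f x} x \<partial>lborel))"
          by (simp add: mult.assoc)
        also have "ennreal (p * l powr (p - 1 - 1)) * 2 = ennreal (2 * p / (p - 1)) * ennreal ((p - 1) * l powr (p - 1 - 1))"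
          using p by (simp flip: ennreal_mult ennreal_numeral)
        finally show ?thesis
          using True by (simp add: D_def ac_simps)
      qed simp
    qed
    also have "\<dots> = D * (\<integral>\<^sup>+l. ennreal ((p - 1) * l powr (p - 1 - 1)) * indicator {0<..} l
         * (\<integral>\<^sup>+x. f x * hl_max w x * indicator {x. ennreal l < 2 * f x} x \<partial>lborel) \<partial>lborel)"
      by (intro nn_integral_cmult) measurable
    also have "\<dots> = D * (\<integral>\<^sup>+x. enn_powr (2 * f x) (p - 1) * (f x * hl_max w x) \<partial>lborel)"
      using p by (subst lborel.nn_integral_enn_powr_layer_cake[of "\<lambda>x. 2 * f x"]) auto
    also have "\<dots> = D * (\<integral>\<^sup>+x. enn_powr 2 (p - 1) * (enn_powr (f x) p * hl_max w x) \<partial>lborel)"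
      using enn_powr_add[of _ "p - 1" 1] by (simp add: enn_powr_mult ac_simps)
    also have "\<dots> = (D * enn_powr 2 (p - 1)) * (\<integral>\<^sup>+x. enn_powr (f x) p * hl_max w x \<partial>lborel)"
      by (subst nn_integral_cmult) (auto simp: mult.assoc)
    finally show ?thesis .
  qed
  moreover have "D * enn_powr 2 (p - 1) < top"
    by (simp add: D_def ennreal_mult_less_top power_less_top_ennreal)
  ultimately show ?thesis
    by blast
qed

section \<open>Vector-valued maximal inequalities\<close>

lemma borel_measurable_emeasure_ball [measurable]:
  fixes c :: "'b \<Rightarrow> 'a::euclidean_space"
  assumes [measurable]: "g \<in> borel_measurable M"
  shows "(\<lambda>w. emeasure lborel (ball (c w) (g w))) \<in> borel_measurable M"
proof -
  have "emeasure lborel (ball (c w) (g w)) = ennreal (unit_ball_vol (DIM('a)) * max 0 (g w) ^ DIM('a))" for w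
    by (cases "0 \<le> g w") (auto simp: emeasure_ball ball_empty zero_power)
  then show ?thesis
    by simp
qed

lemma borel_measurable_indicator_ball [measurable]:
  fixes c k :: "'b \<Rightarrow> 'a::euclidean_space"
  assumes [measurable]: "c \<in> borel_measurable M" "g \<in> borel_measurable M" "k \<in> borel_measurable M"
  shows "(\<lambda>w. indicator (ball (c w) (g w)) (k w) :: ennreal) \<in> borel_measurable M"
  unfolding indicator_def mem_ball by measurable

lemma borel_measurable_infdist [measurable]: "(\<lambda>x. infdist x A) \<in> borel_measurable borel"
  by (intro borel_measurable_continuous_onI continuous_intros)

section \<open>Averages over Whitney balls of an open set\<close>

lemma ennreal_inverse_antimono: "(x :: ennreal) \<le> y \<Longrightarrow> inverse y \<le> inverse x"
  including ennreal.lifting by transfer (rule ereal_inverse_antimono)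

text \<open>Outside \<open>U\<close> the ball is empty and the quotient is \<open>0 / 0 = 0\<close>.\<close>
definition whitney_avg :: "'a set \<Rightarrow> ('a::euclidean_space \<Rightarrow> ennreal) \<Rightarrow> 'a \<Rightarrow> ennreal" where
  "whitney_avg U u w = (\<integral>\<^sup>+z. u z * indicator (ball w (infdist w (- U) / 2)) z \<partial>lborel)
    / emeasure lborel (ball w (infdist w (- U) / 2))"

lemma whitney_avg_outside: "w \<notin> U \<Longrightarrow> whitney_avg U u w = 0"
  by (simp add: whitney_avg_def)

lemma borel_measurable_whitney_avg:
  fixes f :: "'a::euclidean_space \<times> 'b \<Rightarrow> ennreal"
  assumes [measurable]: "f \<in> borel_measurable (lborel \<Otimes>\<^sub>M N)"
  shows "(\<lambda>z. whitney_avg U (\<lambda>y. f (y, snd z)) (fst z)) \<in> borel_measurable (lborel \<Otimes>\<^sub>M N)"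
  unfolding whitney_avg_def by measurable

text \<open>Let z \<in> U \<inter> ball x t have distance d to the complement. On ball z (d/4) that
  distance varies between 3d/4 and 5d/4, so z belongs to the averaging ball of each w there. The
  mass that z passes on to these w is bounded below, and Tonelli replaces u by its averages. As x
  \<notin> U gives d < t, all these w lie in ball x (2 t).\<close>

lemma nn_integral_ball_inter_le_whitney_avg:
  fixes u :: "'a::euclidean_space \<Rightarrow> ennreal"
  assumes [measurable]: "u \<in> borel_measurable borel" and U: "open U" and x: "x \<notin> U"
  shows "(\<integral>\<^sup>+z. u z * indicator U z * indicator (ball x t) z \<partial>lborel)
    \<le> 5 ^ DIM('a) * emeasure lborel (ball x t) * hl_max (whitney_avg U u) x"
proof (cases "0 < t")
  case True
  have [measurable]: "U \<in> sets borel"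
    using U by simp
  define d where "d w = infdist w (- U)" for w
  have [measurable]: "d \<in> borel_measurable borel"
    unfolding d_def by measurable
  \<comment> \<open>Averaging balls centred in ball z (d/4) have radius at most 5d/8 = (5/2)(d/4),
    so these centres receive from z a mass of at least (2/5)^n; c is the reciprocal.\<close>
  define c where "c = ennreal ((5 / 2) ^ DIM('a))"
  define k where "k z w = indicator (ball x (2 * t)) w * indicator (ball w (d w / 2)) z
    / emeasure lborel (ball w (d w / 2))" for z w :: 'a
  have k_ge: "1 \<le> c * (\<integral>\<^sup>+w. k z w \<partial>lborel)" if z: "z \<in> U" "z \<in> ball x t" for z
  proof -
    have D: "0 < d z"
      unfolding d_def using U x z by (intro infdist_pos_not_in_closed) auto
    have Dt: "d z < t"
      using infdist_le[of x "- U" z] x z by (simp add: d_def dist_commute)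
    have V: "emeasure lborel (ball z ((5 / 2) * (d z / 4))) = c * emeasure lborel (ball z (d z / 4))"
      unfolding c_def using D by (intro emeasure_ball_scale) auto
    have pos: "emeasure lborel (ball z ((5 / 2) * (d z / 4))) \<noteq> 0" "emeasure lborel (ball z ((5 / 2) * (d z / 4))) \<noteq> top"
      using D by (auto intro!: emeasure_ball_pos_finite simp del: emeasure_lborel_ball_finite)
    have le: "indicator (ball z (d z / 4)) w / emeasure lborel (ball z ((5 / 2) * (d z / 4))) \<le> k z w" for w
    proof (cases "w \<in> ball z (d z / 4)")
      case True
      then have w: "dist z w < d z / 4"
        by simp
      have dw: "d z \<le> d w + dist z w" "d w \<le> d z + dist z w"
        unfolding d_def using infdist_triangle[of z "- U" w] infdist_triangle[of w "- U" z]
        by (simp_all add: dist_commute)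
      have "dist x w < 2 * t"
        using dist_triangle[of x w z] z w Dt D by simp
      moreover have "dist w z < d w / 2"
        using w dw by (simp add: dist_commute)
      moreover have "emeasure lborel (ball w (d w / 2)) \<le> emeasure lborel (ball w ((5 / 2) * (d z / 4)))"
        using w dw by (intro emeasure_mono subset_ball) auto
      then have "inverse (emeasure lborel (ball w ((5 / 2) * (d z / 4)))) \<le> inverse (emeasure lborel (ball w (d w / 2)))"
        by (rule ennreal_inverse_antimono)
      moreover have "emeasure lborel (ball w ((5 / 2) * (d z / 4))) = emeasure lborel (ball z ((5 / 2) * (d z / 4)))"
        using D by (simp add: emeasure_ball)
      ultimately show ?thesis
        using True by (simp add: k_def divide_ennreal_def)
    qed simp
    have "c * (\<integral>\<^sup>+w. indicator (ball z (d z / 4)) w / emeasure lborel (ball z ((5 / 2) * (d z / 4))) \<partial>lborel)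
      = c * (emeasure lborel (ball z (d z / 4)) / emeasure lborel (ball z ((5 / 2) * (d z / 4))))"
      by (subst nn_integral_divide) auto
    also have "\<dots> = 1"
      using pos unfolding ennreal_times_divide V[symmetric] by (simp add: top.not_eq_extremum)
    finally have "1 = c * (\<integral>\<^sup>+w. indicator (ball z (d z / 4)) w / emeasure lborel (ball z ((5 / 2) * (d z / 4))) \<partial>lborel)"
      by simp
    also have "\<dots> \<le> c * (\<integral>\<^sup>+w. k z w \<partial>lborel)"
      by (intro mult_left_mono nn_integral_mono le) auto
    finally show ?thesis .
  qed
  have [measurable]: "(\<lambda>(z, w). k z w) \<in> borel_measurable (lborel \<Otimes>\<^sub>M lborel)"
    unfolding k_def by measurable
  have k_meas2 [measurable]: "(\<lambda>w. k z w) \<in> borel_measurable borel" for z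
    unfolding k_def by measurable
  have "(\<integral>\<^sup>+z. u z * indicator U z * indicator (ball x t) z \<partial>lborel)
      \<le> (\<integral>\<^sup>+z. c * (\<integral>\<^sup>+w. u z * k z w \<partial>lborel) \<partial>lborel)"
  proof (intro nn_integral_mono)
    fix z
    show "u z * indicator U z * indicator (ball x t) z \<le> c * (\<integral>\<^sup>+w. u z * k z w \<partial>lborel)"
    proof (cases "z \<in> U \<and> z \<in> ball x t")
      case True
      then have "u z * 1 \<le> u z * (c * (\<integral>\<^sup>+w. k z w \<partial>lborel))"
        by (intro mult_left_mono k_ge) auto
      then show ?thesis
        using True by (subst nn_integral_cmult) (auto simp: ac_simps)
    qed auto
  qed
  also have "\<dots> = c * (\<integral>\<^sup>+z. (\<integral>\<^sup>+w. u z * k z w \<partial>lborel) \<partial>lborel)"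
    by (intro nn_integral_cmult) measurable
  also have "(\<integral>\<^sup>+z. (\<integral>\<^sup>+w. u z * k z w \<partial>lborel) \<partial>lborel) = (\<integral>\<^sup>+w. (\<integral>\<^sup>+z. u z * k z w \<partial>lborel) \<partial>lborel)"
    by (intro lborel_pair.Fubini') measurable
  also have "\<dots> = (\<integral>\<^sup>+w. whitney_avg U u w * indicator (ball x (2 * t)) w \<partial>lborel)"
  proof (intro nn_integral_cong)
    fix w
    have "(\<integral>\<^sup>+z. u z * k z w \<partial>lborel)
      = (\<integral>\<^sup>+z. (u z * indicator (ball w (d w / 2)) z) * (indicator (ball x (2 * t)) w / emeasure lborel (ball w (d w / 2))) \<partial>lborel)"
      unfolding k_def by (intro nn_integral_cong) (simp add: divide_ennreal_def ac_simps)
    also have "\<dots> = whitney_avg U u w * indicator (ball x (2 * t)) w"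
      unfolding whitney_avg_def d_def
      by (subst nn_integral_multc) (auto simp: divide_ennreal_def ac_simps)
    finally show "(\<integral>\<^sup>+z. u z * k z w \<partial>lborel) = whitney_avg U u w * indicator (ball x (2 * t)) w" .
  qed
  also have "\<dots> \<le> emeasure lborel (ball x (2 * t)) * hl_max (whitney_avg U u) x"
    by (rule nn_integral_ball_le_hl_max)
  also have "emeasure lborel (ball x (2 * t)) = ennreal (2 ^ DIM('a)) * emeasure lborel (ball x t)"
    using True by (intro emeasure_ball_scale) auto
  also have "c * (ennreal (2 ^ DIM('a)) * emeasure lborel (ball x t) * hl_max (whitney_avg U u) x)
     = (c * ennreal (2 ^ DIM('a))) * emeasure lborel (ball x t) * hl_max (whitney_avg U u) x"
    by (simp add: mult.assoc)
  \<comment> \<open>Doubling the radius of ball x t supplies the factor 2^n that clears the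
    denominator of c.\<close>
  also have "c * ennreal (2 ^ DIM('a)) = 5 ^ DIM('a)"
  proof -
    have "c * ennreal (2 ^ DIM('a)) = ennreal ((5 / 2) ^ DIM('a) * 2 ^ DIM('a))"
      unfolding c_def by (intro ennreal_mult[symmetric]) auto
    also have "(5 / 2) ^ DIM('a) * 2 ^ DIM('a) = (5::real) ^ DIM('a)"
      by (subst power_mult_distrib[symmetric]) simp
    finally show ?thesis
      using ennreal_power[of 5 "DIM('a)"] by simp
  qed
  finally show ?thesis
    by (simp add: mult_left_mono)
qed (simp add: ball_empty)

lemma hl_max_le_off_open:
  fixes u :: "'a::euclidean_space \<Rightarrow> ennreal"
  assumes [measurable]: "u \<in> borel_measurable borel" and U: "open U" and x: "x \<notin> U"
  shows "hl_max u x \<le> hl_max (\<lambda>y. u y * indicator (- U) y) x + 5 ^ DIM('a) * hl_max (whitney_avg U u) x"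
proof -
  have [measurable]: "U \<in> sets borel" "- U \<in> sets borel"
    using U by auto
  have "hl_max u x = hl_max (\<lambda>y. u y * indicator (- U) y + u y * indicator U y) x"
    by (intro arg_cong[where f = "\<lambda>v. hl_max v x"]) (auto split: split_indicator)
  also have "\<dots> \<le> hl_max (\<lambda>y. u y * indicator (- U) y) x + hl_max (\<lambda>y. u y * indicator U y) x"
    by (intro hl_max_add_le) measurable
  also have "hl_max (\<lambda>y. u y * indicator U y) x \<le> 5 ^ DIM('a) * hl_max (whitney_avg U u) x"
    unfolding hl_max_le_iff using nn_integral_ball_inter_le_whitney_avg[OF assms]
    by (simp add: ac_simps)
  finally show ?thesis
    by (simp add: add_left_mono)
qed

text \<open>The averaging ball has radius d/2 and reaches at most 3d/2 from a nearest point x of the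
  complement, where the averages of u are at most c. It fits into the ball of radius 2d = 4 (d/2)
  about x, whence 4^n.\<close>

lemma whitney_avg_le:
  fixes u :: "'a::euclidean_space \<Rightarrow> ennreal"
  assumes U: "open U" "U \<noteq> UNIV" and w: "w \<in> U" and le: "\<And>x. x \<notin> U \<Longrightarrow> hl_max u x \<le> c"
  shows "whitney_avg U u w \<le> 4 ^ DIM('a) * c"
proof -
  define d where "d = infdist w (- U)"
  have d: "0 < d"
    unfolding d_def using U w by (intro infdist_pos_not_in_closed) auto
  have "closed (- U)" "- U \<noteq> {}"
    using U by auto
  then obtain x where x: "x \<in> - U" "infdist w (- U) = dist w x"
    using infdist_attains_inf by blast
  have sub: "ball w (d / 2) \<subseteq> ball x (4 * (d / 2))"
  proof
    fix y assume "y \<in> ball w (d / 2)"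
    then have "dist w y < d / 2"
      by simp
    moreover have "dist w x = d"
      using x by (simp add: d_def)
    ultimately have "dist x y < 4 * (d / 2)"
      using dist_triangle[of x y w] dist_commute[of x w] d by linarith
    then show "y \<in> ball x (4 * (d / 2))"
      by simp
  qed
  have "(\<integral>\<^sup>+z. u z * indicator (ball w (d / 2)) z \<partial>lborel) \<le> (\<integral>\<^sup>+z. u z * indicator (ball x (4 * (d / 2))) z \<partial>lborel)"
    using sub by (intro nn_integral_mono) (auto split: split_indicator)
  also have "\<dots> \<le> emeasure lborel (ball x (4 * (d / 2))) * hl_max u x"
    by (rule nn_integral_ball_le_hl_max)
  also have "\<dots> \<le> emeasure lborel (ball x (4 * (d / 2))) * c"
    using le x by (intro mult_left_mono) auto
  also have "emeasure lborel (ball x (4 * (d / 2))) = 4 ^ DIM('a) * emeasure lborel (ball w (d / 2))"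
    using d by (subst emeasure_ball_scale[of _ _ _ w]) (auto simp flip: ennreal_power)
  finally show ?thesis
    unfolding whitney_avg_def d_def[symmetric]
    using d by (subst ennreal_divide_le_iff) (auto simp: emeasure_ball_pos_finite ac_simps)
qed

section \<open>Fibre norms and the maximal operator in the first variable\<close>

definition fiber_norm :: "real \<Rightarrow> 'b measure \<Rightarrow> ('a \<times> 'b \<Rightarrow> ennreal) \<Rightarrow> 'a \<Rightarrow> ennreal" where
  "fiber_norm r N f x = enn_powr (\<integral>\<^sup>+s. enn_powr (f (x, s)) r \<partial>N) (1 / r)"

definition fiber_max :: "('a::euclidean_space \<times> 'b \<Rightarrow> ennreal) \<Rightarrow> 'a \<times> 'b \<Rightarrow> ennreal" where
  "fiber_max f z = hl_max (\<lambda>y. f (y, snd z)) (fst z)"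

lemma fiber_norm_powr: "0 < r \<Longrightarrow> enn_powr (fiber_norm r N f x) r = (\<integral>\<^sup>+s. enn_powr (f (x, s)) r \<partial>N)"
  by (simp add: fiber_norm_def)

lemma borel_measurable_fiber_max [measurable]:
  "f \<in> borel_measurable (lborel \<Otimes>\<^sub>M N) \<Longrightarrow> fiber_max f \<in> borel_measurable (lborel \<Otimes>\<^sub>M N)"
  unfolding fiber_max_def[abs_def] by (rule borel_measurable_hl_max_pair)

lemma (in sigma_finite_measure) borel_measurable_fiber_norm [measurable]:
  assumes [measurable]: "f \<in> borel_measurable (lborel \<Otimes>\<^sub>M M)"
  shows "fiber_norm r M f \<in> borel_measurable borel"
proof -
  have "fiber_norm r M f \<in> borel_measurable lborel"
    unfolding fiber_norm_def[abs_def] by measurable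
  then show ?thesis
    by simp
qed

text \<open>The r-th power of the fibre norm is an integral over the fibre, so at this one exponent
  the scalar weighted inequality can be used slice by slice and summed by Tonelli.\<close>

lemma (in sigma_finite_measure) fiber_max_weighted_Lr:
  assumes r: "1 < r"
  shows "\<exists>C<top. \<forall>f w. f \<in> borel_measurable ((lborel :: 'c::euclidean_space measure) \<Otimes>\<^sub>M M) \<longrightarrow> w \<in> borel_measurable borel \<longrightarrow>
      (\<integral>\<^sup>+x. enn_powr (fiber_norm r M (fiber_max f) x) r * w x \<partial>lborel)
        \<le> C * (\<integral>\<^sup>+x. enn_powr (fiber_norm r M f x) r * hl_max w x \<partial>lborel)"
proof -
  interpret pair_sigma_finite "lborel :: 'c measure" M ..
  obtain C where C: "C < top" "\<And>f w :: 'c \<Rightarrow> ennreal. f \<in> borel_measurable borel \<Longrightarrow> w \<in> borel_measurable borel \<Longrightarrow>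
      (\<integral>\<^sup>+x. enn_powr (hl_max f x) r * w x \<partial>lborel) \<le> C * (\<integral>\<^sup>+x. enn_powr (f x) r * hl_max w x \<partial>lborel)"
    using hl_max_strong_type_weighted[OF r] by blast
  have "(\<integral>\<^sup>+x. enn_powr (fiber_norm r M (fiber_max f) x) r * w x \<partial>lborel)
        \<le> C * (\<integral>\<^sup>+x. enn_powr (fiber_norm r M f x) r * hl_max w x \<partial>lborel)"
    if [measurable]: "f \<in> borel_measurable ((lborel :: 'c measure) \<Otimes>\<^sub>M M)" "w \<in> borel_measurable borel" for f w
  proof -
    have "(\<integral>\<^sup>+x. enn_powr (fiber_norm r M (fiber_max f) x) r * w x \<partial>lborel)
      = (\<integral>\<^sup>+x. \<integral>\<^sup>+s. enn_powr (fiber_max f (x, s)) r * w x \<partial>M \<partial>lborel)"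
      using r by (simp add: fiber_norm_powr nn_integral_multc)
    also have "\<dots> = (\<integral>\<^sup>+s. \<integral>\<^sup>+x. enn_powr (fiber_max f (x, s)) r * w x \<partial>lborel \<partial>M)"
      by (intro Fubini'[symmetric]) measurable
    also have "\<dots> \<le> (\<integral>\<^sup>+s. C * (\<integral>\<^sup>+x. enn_powr (f (x, s)) r * hl_max w x \<partial>lborel) \<partial>M)"
    proof (intro nn_integral_mono)
      fix s assume s: "s \<in> space M"
      have "(\<lambda>x. f (x, s)) \<in> borel_measurable lborel"
        using s by measurable
      then show "(\<integral>\<^sup>+x. enn_powr (fiber_max f (x, s)) r * w x \<partial>lborel)
          \<le> C * (\<integral>\<^sup>+x. enn_powr (f (x, s)) r * hl_max w x \<partial>lborel)"
        using C(2)[of "\<lambda>x. f (x, s)" w] by (simp add: fiber_max_def)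
    qed
    also have "\<dots> = C * (\<integral>\<^sup>+s. (\<integral>\<^sup>+x. enn_powr (f (x, s)) r * hl_max w x \<partial>lborel) \<partial>M)"
      by (intro nn_integral_cmult) measurable
    also have "(\<integral>\<^sup>+s. (\<integral>\<^sup>+x. enn_powr (f (x, s)) r * hl_max w x \<partial>lborel) \<partial>M)
        = (\<integral>\<^sup>+x. (\<integral>\<^sup>+s. enn_powr (f (x, s)) r * hl_max w x \<partial>M) \<partial>lborel)"
      by (intro Fubini') measurable
    also have "\<dots> = (\<integral>\<^sup>+x. enn_powr (fiber_norm r M f x) r * hl_max w x \<partial>lborel)"
      using r by (simp add: fiber_norm_powr nn_integral_multc)
    finally show ?thesis .
  qed
  with C(1) show ?thesis
    by blast
qed

lemma (in sigma_finite_measure) fiber_max_Lr: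
  assumes r: "1 < r"
  shows "\<exists>C<top. \<forall>f. f \<in> borel_measurable ((lborel :: 'c::euclidean_space measure) \<Otimes>\<^sub>M M) \<longrightarrow>
      (\<integral>\<^sup>+x. enn_powr (fiber_norm r M (fiber_max f) x) r \<partial>lborel)
        \<le> C * (\<integral>\<^sup>+x. enn_powr (fiber_norm r M f x) r \<partial>lborel)"
proof -
  obtain C where C: "C < top" "\<And>f w. f \<in> borel_measurable ((lborel :: 'c::euclidean_space measure) \<Otimes>\<^sub>M M) \<Longrightarrow> w \<in> borel_measurable borel \<Longrightarrow>
      (\<integral>\<^sup>+x. enn_powr (fiber_norm r M (fiber_max f) x) r * w x \<partial>lborel)
        \<le> C * (\<integral>\<^sup>+x. enn_powr (fiber_norm r M f x) r * hl_max w x \<partial>lborel)"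
    using fiber_max_weighted_Lr[OF r] by blast
  then show ?thesis
    using C(2)[of _ "\<lambda>_. 1"] by (intro exI[of _ C]) simp
qed

text \<open>Minkowski's integral inequality for the averaging measure; the normalised indicator is
  absorbed into g so that the average becomes a plain integral.\<close>

lemma (in sigma_finite_measure) fiber_norm_whitney_avg_le:
  fixes f :: "'c::euclidean_space \<times> 'a \<Rightarrow> ennreal"
  assumes [measurable]: "f \<in> borel_measurable (lborel \<Otimes>\<^sub>M M)" and r: "1 < r"
  shows "fiber_norm r M (\<lambda>z. whitney_avg U (\<lambda>y. f (y, snd z)) (fst z)) w \<le> whitney_avg U (fiber_norm r M f) w"
proof (cases "w \<in> U")
  case True
  interpret pair_sigma_finite "lborel :: 'c measure" M ..
  define B where "B = ball w (infdist w (- U) / 2)"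
  define b where "b = inverse (emeasure lborel B)"
  have [measurable]: "B \<in> sets borel"
    unfolding B_def by simp
  define g where "g z = f z * indicator B (fst z) * b" for z
  have [measurable]: "g \<in> borel_measurable (lborel \<Otimes>\<^sub>M M)"
    unfolding g_def by measurable
  have g: "fiber_norm r M g z = fiber_norm r M f z * indicator B z * b" for z
  proof -
    have "(\<integral>\<^sup>+s. enn_powr (g (z, s)) r \<partial>M) = (\<integral>\<^sup>+s. enn_powr (f (z, s)) r * (indicator B z * enn_powr b r) \<partial>M)"
      by (intro nn_integral_cong) (auto simp: g_def enn_powr_mult split: split_indicator)
    also have "\<dots> = (\<integral>\<^sup>+s. enn_powr (f (z, s)) r \<partial>M) * (indicator B z * enn_powr b r)"
      by (intro nn_integral_multc) simp
    finally show ?thesis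
      using r by (auto simp: fiber_norm_def enn_powr_mult split: split_indicator)
  qed
  have avg: "whitney_avg U u w = (\<integral>\<^sup>+z. u z * indicator B z * b \<partial>lborel)" if "u \<in> borel_measurable lborel" for u
    using that by (simp add: whitney_avg_def B_def b_def divide_ennreal_def nn_integral_multc)
  have "(\<integral>\<^sup>+s. enn_powr (whitney_avg U (\<lambda>y. f (y, s)) w) r \<partial>M)
    = (\<integral>\<^sup>+s. enn_powr (\<integral>\<^sup>+z. g (z, s) \<partial>lborel) r \<partial>M)"
    by (intro nn_integral_cong) (simp add: avg g_def)
  also have "\<dots> \<le> enn_powr (\<integral>\<^sup>+z. fiber_norm r M g z \<partial>lborel) r"
    unfolding fiber_norm_def using r by (intro nn_integral_Minkowski) auto
  also have "(\<integral>\<^sup>+z. fiber_norm r M g z \<partial>lborel) = whitney_avg U (fiber_norm r M f) w"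
    unfolding g by (intro avg[symmetric]) simp
  finally have "enn_powr (\<integral>\<^sup>+s. enn_powr (whitney_avg U (\<lambda>y. f (y, s)) w) r \<partial>M) (1 / r)
    \<le> enn_powr (enn_powr (whitney_avg U (fiber_norm r M f) w) r) (1 / r)"
    using r by (intro enn_powr_mono) auto
  then show ?thesis
    using r by (simp add: fiber_norm_def)
qed (simp add: fiber_norm_def whitney_avg_outside)

text \<open>Off U the operator is controlled by its values on g, the part of f off U, and on k, the
  Whitney averages. Both have r-th power integrals of the claimed size: the norm of g is at most
  min(h,l), and k lives on U with norm at most 4^n l. Chebyshev and the L^r bound finish off U; the
  measure of U pays for U itself.\<close>

lemma (in sigma_finite_measure) fiber_max_level_estimate:
  assumes r: "1 < r"
  shows "\<exists>C<top. \<forall>f l. f \<in> borel_measurable ((lborel :: 'c::euclidean_space measure) \<Otimes>\<^sub>M M) \<longrightarrow>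
      (AE x in lborel. fiber_norm r M f x \<le> hl_max (fiber_norm r M f) x) \<longrightarrow> 0 < l \<longrightarrow>
      ennreal (l powr r) * emeasure lborel {x. ennreal l < fiber_norm r M (fiber_max f) x}
        \<le> C * (ennreal (l powr r) * emeasure lborel {x. ennreal l < hl_max (fiber_norm r M f) x}
               + (\<integral>\<^sup>+x. enn_powr (min (fiber_norm r M f x) (ennreal l)) r \<partial>lborel))"
proof -
  obtain A where A: "A < top" "\<And>f. f \<in> borel_measurable ((lborel :: 'c measure) \<Otimes>\<^sub>M M) \<Longrightarrow>
      (\<integral>\<^sup>+x. enn_powr (fiber_norm r M (fiber_max f) x) r \<partial>lborel) \<le> A * (\<integral>\<^sup>+x. enn_powr (fiber_norm r M f x) r \<partial>lborel)"
    using fiber_max_Lr[OF r] by blast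
  define n where "n = DIM('c)"
  \<comment> \<open>P collects the contribution of g and Q that of k; 2^r is the price of the power
    of a sum, 5^n and 4^n are the two Whitney constants, and the 1 in 1 + P + Q accounts for
    U.\<close>
  define P where "P = enn_powr 2 r * A"
  define Q where "Q = enn_powr 2 r * (enn_powr (5 ^ n) r * (A * enn_powr (4 ^ n) r))"
  have fin: "1 + P + Q < top"
    unfolding P_def Q_def using A by (simp add: ennreal_mult_less_top power_less_top_ennreal)
  have "ennreal (l powr r) * emeasure lborel {x. ennreal l < fiber_norm r M (fiber_max f) x}
        \<le> (1 + P + Q) * (ennreal (l powr r) * emeasure lborel {x. ennreal l < hl_max (fiber_norm r M f) x}
               + (\<integral>\<^sup>+x. enn_powr (min (fiber_norm r M f x) (ennreal l)) r \<partial>lborel))"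
    if [measurable]: "f \<in> borel_measurable ((lborel :: 'c measure) \<Otimes>\<^sub>M M)"
      and le: "AE x in lborel. fiber_norm r M f x \<le> hl_max (fiber_norm r M f) x" and l: "0 < l" for f l
  proof -
    define h where "h = fiber_norm r M f"
    have [measurable]: "h \<in> borel_measurable borel"
      unfolding h_def by measurable
    define S where "S = fiber_norm r M (fiber_max f)"
    have [measurable]: "S \<in> borel_measurable borel"
      unfolding S_def by measurable
    define U where "U = {x. ennreal l < hl_max h x}"
    have U: "open U"
      unfolding U_def by (intro open_superlevel_hl_max) simp
    then have [measurable]: "U \<in> sets borel" "- U \<in> sets borel"
      by auto
    define L where "L = ennreal (l powr r)"
    have L: "enn_powr (ennreal l) r = L" "L \<noteq> 0" "L \<noteq> top"
      using l by (auto simp: L_def enn_powr_ennreal)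
    define I where "I = (\<integral>\<^sup>+x. enn_powr (min (h x) (ennreal l)) r \<partial>lborel)"
    have "L * emeasure lborel {x. ennreal l < S x} \<le> (1 + P + Q) * (L * emeasure lborel U + I)"
    \<comment> \<open>With an empty complement \<open>infdist\<close> defaults to 0 and the averages
      degenerate, but then U has infinite measure and the right-hand side is top.\<close>
    proof (cases "U = UNIV")
      case True
      then have "L * emeasure lborel U = top"
        using L by (simp add: ennreal_mult_eq_top_iff)
      then show ?thesis
        by (simp add: ennreal_mult_top)
    next
      case False
      define g where "g z = f z * indicator (- U) (fst z)" for z
      have [measurable]: "g \<in> borel_measurable (lborel \<Otimes>\<^sub>M M)"
        unfolding g_def by measurable
      define k where "k z = whitney_avg U (\<lambda>y. f (y, snd z)) (fst z)" for z
      have [measurable]: "k \<in> borel_measurable (lborel \<Otimes>\<^sub>M M)"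
        unfolding k_def[abs_def] by (intro borel_measurable_whitney_avg) measurable
      have max_le: "fiber_max f (x, s) \<le> fiber_max g (x, s) + 5 ^ n * fiber_max k (x, s)"
        if "x \<notin> U" "s \<in> space M" for x s
      proof -
        have "(\<lambda>y. f (y, s)) \<in> borel_measurable lborel"
          using that(2) by measurable
        then show ?thesis
          using hl_max_le_off_open[of "\<lambda>y. f (y, s)" U x] that(1) U
          by (simp add: fiber_max_def g_def k_def n_def)
      qed
      have S_le: "enn_powr (S x) r \<le> enn_powr 2 r * (enn_powr (fiber_norm r M (fiber_max g) x) r
            + enn_powr (5 ^ n) r * enn_powr (fiber_norm r M (fiber_max k) x) r)" if "x \<notin> U" for x
      proof -
        have "enn_powr (S x) r = (\<integral>\<^sup>+s. enn_powr (fiber_max f (x, s)) r \<partial>M)"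
          using r by (simp add: S_def fiber_norm_powr)
        also have "\<dots> \<le> (\<integral>\<^sup>+s. enn_powr 2 r * (enn_powr (fiber_max g (x, s)) r
            + enn_powr (5 ^ n) r * enn_powr (fiber_max k (x, s)) r) \<partial>M)"
        proof (intro nn_integral_mono)
          fix s assume "s \<in> space M"
          then have "enn_powr (fiber_max f (x, s)) r \<le> enn_powr (fiber_max g (x, s) + 5 ^ n * fiber_max k (x, s)) r"
            using that r by (intro enn_powr_mono max_le) auto
          also have "\<dots> \<le> enn_powr 2 r * (enn_powr (fiber_max g (x, s)) r + enn_powr (5 ^ n * fiber_max k (x, s)) r)"
            using r by (intro enn_powr_plus_le) auto
          finally show "enn_powr (fiber_max f (x, s)) r
              \<le> enn_powr 2 r * (enn_powr (fiber_max g (x, s)) r + enn_powr (5 ^ n) r * enn_powr (fiber_max k (x, s)) r)"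
            by (simp add: enn_powr_mult)
        qed
        also have "\<dots> = enn_powr 2 r * (enn_powr (fiber_norm r M (fiber_max g) x) r
            + enn_powr (5 ^ n) r * enn_powr (fiber_norm r M (fiber_max k) x) r)"
          using r by (simp add: nn_integral_cmult nn_integral_add fiber_norm_powr)
        finally show ?thesis .
      qed
      \<comment> \<open>The bound h \<le> Mh enters here: off U it gives h \<le> l almost
        everywhere, so min(h,l) is h itself there.\<close>
      have gI: "(\<integral>\<^sup>+x. enn_powr (fiber_norm r M g x) r \<partial>lborel) \<le> I"
        unfolding I_def
      proof (rule nn_integral_mono_AE)
        show "AE x in lborel. enn_powr (fiber_norm r M g x) r \<le> enn_powr (min (h x) (ennreal l)) r"
          using le
        proof eventually_elim
          case (elim x)
          show ?case
          proof (cases "x \<in> U")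
            case False
            then have "h x \<le> ennreal l"
              using elim by (auto simp: U_def h_def not_less)
            with False show ?thesis
              by (simp add: fiber_norm_def g_def h_def min_absorb1)
          qed (simp add: fiber_norm_def g_def)
        qed
      qed
      have kU: "(\<integral>\<^sup>+x. enn_powr (fiber_norm r M k x) r \<partial>lborel) \<le> enn_powr (4 ^ n) r * (L * emeasure lborel U)"
      proof -
        have "enn_powr (fiber_norm r M k x) r \<le> enn_powr (4 ^ n) r * L * indicator U x" for x
        proof -
          have k_le: "fiber_norm r M k x \<le> whitney_avg U h x"
            unfolding k_def[abs_def] h_def using r by (intro fiber_norm_whitney_avg_le) auto
          show ?thesis
          proof (cases "x \<in> U")
            case True
            then have "whitney_avg U h x \<le> 4 ^ n * ennreal l"
              unfolding n_def using U False by (intro whitney_avg_le) (auto simp: U_def not_less)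
            with k_le have "enn_powr (fiber_norm r M k x) r \<le> enn_powr (4 ^ n * ennreal l) r"
              using r by (intro enn_powr_mono) auto
            then show ?thesis
              using True by (simp add: enn_powr_mult L)
          qed (use k_le whitney_avg_outside in \<open>simp add: whitney_avg_outside\<close>)
        qed
        then have "(\<integral>\<^sup>+x. enn_powr (fiber_norm r M k x) r \<partial>lborel)
            \<le> (\<integral>\<^sup>+x. enn_powr (4 ^ n) r * L * indicator U x \<partial>lborel)"
          by (rule nn_integral_mono)
        also have "\<dots> = enn_powr (4 ^ n) r * (L * emeasure lborel U)"
          by (subst nn_integral_cmult_indicator) (auto simp: mult.assoc)
        finally show ?thesis .
      qed
      have "L * emeasure lborel {x. ennreal l < S x}
        = (\<integral>\<^sup>+x. L * indicator {x. ennreal l < S x} x \<partial>lborel)"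
        by (subst nn_integral_cmult_indicator) auto
      \<comment> \<open>Chebyshev off U; on U the first summand alone suffices.\<close>
      also have "\<dots> \<le> (\<integral>\<^sup>+x. L * indicator U x + enn_powr 2 r * (enn_powr (fiber_norm r M (fiber_max g) x) r
            + enn_powr (5 ^ n) r * enn_powr (fiber_norm r M (fiber_max k) x) r) \<partial>lborel)"
      proof (intro nn_integral_mono)
        fix x
        show "L * indicator {x. ennreal l < S x} x \<le> L * indicator U x + enn_powr 2 r * (enn_powr (fiber_norm r M (fiber_max g) x) r
            + enn_powr (5 ^ n) r * enn_powr (fiber_norm r M (fiber_max k) x) r)"
        proof (cases "x \<in> U")
          case True
          then show ?thesis
            by (intro add_increasing2) (auto split: split_indicator)
        next
          case False
          have "L * indicator {x. ennreal l < S x} x \<le> enn_powr (S x) r"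
            using enn_powr_mono[of "ennreal l" "S x" r] r L by (auto split: split_indicator)
          then show ?thesis
            using S_le[OF False] False by simp
        qed
      qed
      also have "\<dots> = L * emeasure lborel U + enn_powr 2 r * ((\<integral>\<^sup>+x. enn_powr (fiber_norm r M (fiber_max g) x) r \<partial>lborel)
            + enn_powr (5 ^ n) r * (\<integral>\<^sup>+x. enn_powr (fiber_norm r M (fiber_max k) x) r \<partial>lborel))"
        by (simp add: nn_integral_add nn_integral_cmult nn_integral_cmult_indicator)
      also have "\<dots> \<le> L * emeasure lborel U + enn_powr 2 r * (A * I + enn_powr (5 ^ n) r * (A * (enn_powr (4 ^ n) r * (L * emeasure lborel U))))"
        by (intro add_mono mult_left_mono order_refl order_trans[OF A(2)] gI kU) auto
      also have "\<dots> = L * emeasure lborel U + P * I + Q * (L * emeasure lborel U)"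
        by (simp add: P_def Q_def distrib_left ac_simps)
      also have "\<dots> \<le> (1 + P + Q) * (L * emeasure lborel U + I)"
        by (simp add: distrib_left distrib_right add.assoc add_mono add_increasing add_increasing2)
      finally show ?thesis .
    qed
    then show ?thesis
      unfolding L_def I_def U_def S_def h_def .
  qed
  with fin show ?thesis
    by blast
qed

text \<open>As min(h,l)^r \<le> l^(r-1) h, the integral term of the level estimate is at most
  l^(r-1) times the integral of h. The scalar weak type treats the other term, and the common factor
  l^(r-1) cancels.\<close>

lemma (in sigma_finite_measure) fiber_max_weak_type:
  assumes r: "1 < r"
  shows "\<exists>C<top. \<forall>f l. f \<in> borel_measurable ((lborel :: 'c::euclidean_space measure) \<Otimes>\<^sub>M M) \<longrightarrow>
      (AE x in lborel. fiber_norm r M f x \<le> hl_max (fiber_norm r M f) x) \<longrightarrow> 0 < l \<longrightarrow>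
      ennreal l * emeasure lborel {x. ennreal l < fiber_norm r M (fiber_max f) x}
        \<le> C * (\<integral>\<^sup>+x. fiber_norm r M f x \<partial>lborel)"
proof -
  obtain A where A: "A < top" "\<And>f l. f \<in> borel_measurable ((lborel :: 'c measure) \<Otimes>\<^sub>M M) \<Longrightarrow>
      (AE x in lborel. fiber_norm r M f x \<le> hl_max (fiber_norm r M f) x) \<Longrightarrow> 0 < l \<Longrightarrow>
      ennreal (l powr r) * emeasure lborel {x. ennreal l < fiber_norm r M (fiber_max f) x}
        \<le> A * (ennreal (l powr r) * emeasure lborel {x. ennreal l < hl_max (fiber_norm r M f) x}
               + (\<integral>\<^sup>+x. enn_powr (min (fiber_norm r M f x) (ennreal l)) r \<partial>lborel))"
    using fiber_max_level_estimate[OF r] by blast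
  have "ennreal l * emeasure lborel {x. ennreal l < fiber_norm r M (fiber_max f) x}
        \<le> (A * (6 ^ DIM('c) + 1)) * (\<integral>\<^sup>+x. fiber_norm r M f x \<partial>lborel)"
    if [measurable]: "f \<in> borel_measurable ((lborel :: 'c measure) \<Otimes>\<^sub>M M)"
      and le: "AE x in lborel. fiber_norm r M f x \<le> hl_max (fiber_norm r M f) x" and l: "0 < l" for f l
  proof -
    define h where "h = fiber_norm r M f"
    have [measurable]: "h \<in> borel_measurable borel"
      unfolding h_def by measurable
    define L where "L = ennreal (l powr (r - 1))"
    have L: "ennreal (l powr r) = L * ennreal l" "L \<noteq> 0" "L \<noteq> top" "enn_powr (ennreal l) (r - 1) = L"
      using l by (auto simp: L_def enn_powr_ennreal powr_diff simp flip: ennreal_mult)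
    have "(\<integral>\<^sup>+x. enn_powr (min (h x) (ennreal l)) r \<partial>lborel) \<le> (\<integral>\<^sup>+x. L * h x \<partial>lborel)"
    proof (intro nn_integral_mono)
      fix x
      have "enn_powr (min (h x) (ennreal l)) r = enn_powr (min (h x) (ennreal l)) (r - 1) * min (h x) (ennreal l)"
        using enn_powr_add[of _ "r - 1" 1] by simp
      also have "\<dots> \<le> enn_powr (ennreal l) (r - 1) * h x"
        using r by (intro mult_mono enn_powr_mono) auto
      finally show "enn_powr (min (h x) (ennreal l)) r \<le> L * h x"
        by (simp add: L)
    qed
    also have "\<dots> = L * (\<integral>\<^sup>+x. h x \<partial>lborel)"
      by (simp add: nn_integral_cmult)
    finally have I: "(\<integral>\<^sup>+x. enn_powr (min (h x) (ennreal l)) r \<partial>lborel) \<le> L * (\<integral>\<^sup>+x. h x \<partial>lborel)" .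
    have "L * (ennreal l * emeasure lborel {x. ennreal l < fiber_norm r M (fiber_max f) x})
      \<le> A * (L * (ennreal l * emeasure lborel {x. ennreal l < hl_max h x})
               + (\<integral>\<^sup>+x. enn_powr (min (h x) (ennreal l)) r \<partial>lborel))"
      using A(2)[OF that] unfolding h_def L(1) by (simp add: mult.assoc)
    also have "\<dots> \<le> A * (L * (6 ^ DIM('c) * (\<integral>\<^sup>+x. h x \<partial>lborel)) + L * (\<integral>\<^sup>+x. h x \<partial>lborel))"
      using I by (intro mult_left_mono add_mono hl_max_weak_type) auto
    also have "\<dots> = L * ((A * (6 ^ DIM('c) + 1)) * (\<integral>\<^sup>+x. h x \<partial>lborel))"
      by (simp add: distrib_left distrib_right ac_simps)
    finally show ?thesis
      using L unfolding h_def by (simp add: ennreal_mult_le_mult_iff)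
  qed
  moreover have "A * (6 ^ DIM('c) + 1) < top"
    using A by (simp add: ennreal_mult_less_top power_less_top_ennreal)
  ultimately show ?thesis
    by blast
qed

section \<open>Strong type bounds by interpolation and duality\<close>

lemma nn_integral_powr_min:
  assumes q: "0 < q" "q < r"
  shows "(\<integral>\<^sup>+l. ennreal (q * l powr (q - 1 - r)) * indicator {0<..} l * enn_powr (min y (ennreal l)) r \<partial>lborel)
    \<le> (1 + ennreal (q / (r - q))) * enn_powr y q"
proof (cases y)
  case (real a)
  show ?thesis
  proof (cases "a = 0")
    case False
    with real have a: "0 < a"
      by simp
    \<comment> \<open>Below a the minimum is l and the powers combine to the layer-cake kernel,
      which yields y^q; from a on the minimum is a, and q < r makes the tail of l^(q-1-r) converge,
      which yields q / (r - q) times y^q.\<close>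
    have "ennreal (q * l powr (q - 1 - r)) * indicator {0<..} l * enn_powr (min y (ennreal l)) r
      \<le> ennreal (q * l powr (q - 1)) * indicator {l. 0 < l \<and> ennreal l < y} l
        + ennreal (q * a powr r) * (ennreal (l powr (q - 1 - r)) * indicator {a..} l)" for l
    proof -
      consider "l \<le> 0" | "0 < l" "l < a" | "0 < l" "a \<le> l"
        by linarith
      then show ?thesis
      proof cases
        case 2
        then have "min y (ennreal l) = ennreal l" "ennreal l < y"
          using real by (auto simp: min_def ennreal_leI ennreal_less_iff)
        then show ?thesis
          using 2 q by (simp add: enn_powr_ennreal powr_add[symmetric] flip: ennreal_mult)
      next
        case 3
        then have "min y (ennreal l) = ennreal a"
          using real by (auto simp: min_def)
        then show ?thesis
          using 3 q a by (simp add: enn_powr_ennreal ac_simps add_increasing flip: ennreal_mult)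
      qed simp
    qed
    then have "(\<integral>\<^sup>+l. ennreal (q * l powr (q - 1 - r)) * indicator {0<..} l * enn_powr (min y (ennreal l)) r \<partial>lborel)
      \<le> (\<integral>\<^sup>+l. ennreal (q * l powr (q - 1)) * indicator {l. 0 < l \<and> ennreal l < y} l
        + ennreal (q * a powr r) * (ennreal (l powr (q - 1 - r)) * indicator {a..} l) \<partial>lborel)"
      by (intro nn_integral_mono)
    also have "\<dots> = (\<integral>\<^sup>+l. ennreal (q * l powr (q - 1)) * indicator {l. 0 < l \<and> ennreal l < y} l \<partial>lborel)
       + ennreal (q * a powr r) * (\<integral>\<^sup>+l. ennreal (l powr (q - 1 - r)) * indicator {a..} l \<partial>lborel)"
      by (subst nn_integral_add) (auto simp: nn_integral_cmult)
    also have "\<dots> = enn_powr y q + ennreal (q * a powr r) * ennreal (a powr (- (r - q)) / (r - q))"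
      using q a nn_integral_powr_to_inf[of "r - q" a] by (simp add: nn_integral_powr_from_0 algebra_simps)
    also have "ennreal (q * a powr r) * ennreal (a powr (- (r - q)) / (r - q)) = ennreal (q / (r - q)) * enn_powr y q"
      using q a real by (simp add: enn_powr_ennreal powr_diff powr_minus flip: ennreal_mult)
    finally show ?thesis
      by (simp add: distrib_right)
  qed (simp add: real)
qed (simp add: ennreal_mult_top)

text \<open>The level estimate is multiplied by q l^(q-1-r) and integrated in l. Its first term
  becomes the q-th power integral of Mh, where q > 1 enters; the second is evaluated for each x by
  \<open>nn_integral_powr_min\<close>, where q < r enters.\<close>

lemma (in sigma_finite_measure) fiber_max_strong_type_lower:
  assumes r: "1 < r" and q: "1 < q" "q < r"
  shows "\<exists>C<top. \<forall>f. f \<in> borel_measurable ((lborel :: 'c::euclidean_space measure) \<Otimes>\<^sub>M M) \<longrightarrow>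
      (AE x in lborel. fiber_norm r M f x \<le> hl_max (fiber_norm r M f) x) \<longrightarrow>
      (\<integral>\<^sup>+x. enn_powr (fiber_norm r M (fiber_max f) x) q \<partial>lborel)
        \<le> C * (\<integral>\<^sup>+x. enn_powr (fiber_norm r M f x) q \<partial>lborel)"
proof -
  obtain A where A: "A < top" "\<And>f l. f \<in> borel_measurable ((lborel :: 'c measure) \<Otimes>\<^sub>M M) \<Longrightarrow>
      (AE x in lborel. fiber_norm r M f x \<le> hl_max (fiber_norm r M f) x) \<Longrightarrow> 0 < l \<Longrightarrow>
      ennreal (l powr r) * emeasure lborel {x. ennreal l < fiber_norm r M (fiber_max f) x}
        \<le> A * (ennreal (l powr r) * emeasure lborel {x. ennreal l < hl_max (fiber_norm r M f) x}
               + (\<integral>\<^sup>+x. enn_powr (min (fiber_norm r M f x) (ennreal l)) r \<partial>lborel))"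
    using fiber_max_level_estimate[OF r] by blast
  obtain B where B: "B < top" "\<And>f w :: 'c \<Rightarrow> ennreal. f \<in> borel_measurable borel \<Longrightarrow> w \<in> borel_measurable borel \<Longrightarrow>
      (\<integral>\<^sup>+x. enn_powr (hl_max f x) q * w x \<partial>lborel) \<le> B * (\<integral>\<^sup>+x. enn_powr (f x) q * hl_max w x \<partial>lborel)"
    using hl_max_strong_type_weighted[OF q(1)] by blast
  define D where "D = 1 + ennreal (q / (r - q))"
  have "(\<integral>\<^sup>+x. enn_powr (fiber_norm r M (fiber_max f) x) q \<partial>lborel)
        \<le> (A * (B + D)) * (\<integral>\<^sup>+x. enn_powr (fiber_norm r M f x) q \<partial>lborel)"
    if [measurable]: "f \<in> borel_measurable ((lborel :: 'c measure) \<Otimes>\<^sub>M M)"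
      and le: "AE x in lborel. fiber_norm r M f x \<le> hl_max (fiber_norm r M f) x" for f
  proof -
    define h where "h = fiber_norm r M f"
    have [measurable]: "h \<in> borel_measurable borel"
      unfolding h_def by measurable
    define S where "S = fiber_norm r M (fiber_max f)"
    have [measurable]: "S \<in> borel_measurable borel"
      unfolding S_def by measurable
    define H where "H = (\<integral>\<^sup>+x. enn_powr (h x) q \<partial>lborel)"
    have cake: "(\<integral>\<^sup>+x. enn_powr (g x) q \<partial>lborel)
        = (\<integral>\<^sup>+l. ennreal (q * l powr (q - 1)) * indicator {0<..} l * emeasure lborel {x. ennreal l < g x} \<partial>lborel)"
      if [measurable]: "g \<in> borel_measurable borel" for g :: "'c \<Rightarrow> ennreal"
      using lborel.nn_integral_enn_powr_layer_cake[of g "\<lambda>_. 1" q] q by simp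
    have "(\<integral>\<^sup>+x. enn_powr (S x) q \<partial>lborel)
        = (\<integral>\<^sup>+l. ennreal (q * l powr (q - 1)) * indicator {0<..} l * emeasure lborel {x. ennreal l < S x} \<partial>lborel)"
      by (intro cake) simp
    also have "\<dots> \<le> (\<integral>\<^sup>+l. A * (ennreal (q * l powr (q - 1)) * indicator {0<..} l * emeasure lborel {x. ennreal l < hl_max h x}
        + (\<integral>\<^sup>+x. ennreal (q * l powr (q - 1 - r)) * indicator {0<..} l * enn_powr (min (h x) (ennreal l)) r \<partial>lborel)) \<partial>lborel)"
    proof (intro nn_integral_mono)
      fix l :: real
      show "ennreal (q * l powr (q - 1)) * indicator {0<..} l * emeasure lborel {x. ennreal l < S x}
        \<le> A * (ennreal (q * l powr (q - 1)) * indicator {0<..} l * emeasure lborel {x. ennreal l < hl_max h x}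
        + (\<integral>\<^sup>+x. ennreal (q * l powr (q - 1 - r)) * indicator {0<..} l * enn_powr (min (h x) (ennreal l)) r \<partial>lborel))"
      proof (cases "0 < l")
        case True
        define c where "c = ennreal (q * l powr (q - 1 - r))"
        have c: "ennreal (q * l powr (q - 1)) = c * ennreal (l powr r)"
          unfolding c_def using True q by (simp add: powr_add[symmetric] flip: ennreal_mult)
        have "c * (ennreal (l powr r) * emeasure lborel {x. ennreal l < S x})
          \<le> c * (A * (ennreal (l powr r) * emeasure lborel {x. ennreal l < hl_max h x}
               + (\<integral>\<^sup>+x. enn_powr (min (h x) (ennreal l)) r \<partial>lborel)))"
          using A(2)[OF that True] unfolding S_def h_def by (intro mult_left_mono) auto
        also have "\<dots> = A * (c * ennreal (l powr r) * emeasure lborel {x. ennreal l < hl_max h x}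
               + (\<integral>\<^sup>+x. c * enn_powr (min (h x) (ennreal l)) r \<partial>lborel))"
          by (subst nn_integral_cmult) (auto simp: distrib_left ac_simps)
        finally show ?thesis
          using True unfolding c by (simp add: c_def mult.assoc)
      qed simp
    qed
    also have "\<dots> = A * ((\<integral>\<^sup>+l. ennreal (q * l powr (q - 1)) * indicator {0<..} l * emeasure lborel {x. ennreal l < hl_max h x} \<partial>lborel)
        + (\<integral>\<^sup>+l. \<integral>\<^sup>+x. ennreal (q * l powr (q - 1 - r)) * indicator {0<..} l * enn_powr (min (h x) (ennreal l)) r \<partial>lborel \<partial>lborel))"
    proof -
      \<comment> \<open>Measurable in l because it is the integral of an indicator jointly
        measurable in x and l.\<close>
      have "(\<lambda>l. emeasure lborel {x. ennreal l < hl_max h x}) \<in> borel_measurable borel"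
      proof -
        have "(\<lambda>l. \<integral>\<^sup>+x. indicator {x. ennreal l < hl_max h x} x \<partial>lborel) \<in> borel_measurable borel"
          by measurable
        then show ?thesis
          by simp
      qed
      then show ?thesis
        by (subst nn_integral_cmult, measurable, subst nn_integral_add, measurable)
    qed
    also have "(\<integral>\<^sup>+l. ennreal (q * l powr (q - 1)) * indicator {0<..} l * emeasure lborel {x. ennreal l < hl_max h x} \<partial>lborel)
        = (\<integral>\<^sup>+x. enn_powr (hl_max h x) q \<partial>lborel)"
      by (intro cake[symmetric]) simp
    also have "\<dots> \<le> B * H"
      using B(2)[of h "\<lambda>_. 1"] by (simp add: H_def)
    also have "(\<integral>\<^sup>+l. \<integral>\<^sup>+x. ennreal (q * l powr (q - 1 - r)) * indicator {0<..} l * enn_powr (min (h x) (ennreal l)) r \<partial>lborel \<partial>lborel)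
      = (\<integral>\<^sup>+x. \<integral>\<^sup>+l. ennreal (q * l powr (q - 1 - r)) * indicator {0<..} l * enn_powr (min (h x) (ennreal l)) r \<partial>lborel \<partial>lborel)"
      by (intro lborel_pair.Fubini') measurable
    also have "\<dots> \<le> (\<integral>\<^sup>+x. D * enn_powr (h x) q \<partial>lborel)"
      unfolding D_def using q by (intro nn_integral_mono nn_integral_powr_min) auto
    also have "\<dots> = D * H"
      by (simp add: nn_integral_cmult H_def)
    finally show ?thesis
      by (simp add: S_def h_def H_def distrib_left distrib_right add_mono mult_left_mono mult.assoc)
  qed
  moreover have "A * (B + D) < top"
    using A(1) B(1) by (simp add: ennreal_mult_less_top D_def)
  ultimately show ?thesis
    by blast
qed

text \<open>Duality with an explicit weight w = U^(q-r), U a truncation of S. The integral I of U^q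
  is at most that of S^r w, hence at most A times that of h^r Mw. Holder with exponents q/r and
  q/(q-r), whose reciprocals are a and b, and the scalar bound for M at the exponent q/(q-r) return
  a power of I below 1, which can be cancelled.\<close>

lemma (in sigma_finite_measure) fiber_max_strong_type_upper:
  assumes r: "1 < r" and q: "r < q"
  shows "\<exists>C<top. \<forall>f. f \<in> borel_measurable ((lborel :: 'c::euclidean_space measure) \<Otimes>\<^sub>M M) \<longrightarrow>
      (\<integral>\<^sup>+x. enn_powr (fiber_norm r M (fiber_max f) x) q \<partial>lborel)
        \<le> C * (\<integral>\<^sup>+x. enn_powr (fiber_norm r M f x) q \<partial>lborel)"
proof -
  define a b where "a = r / q" and "b = (q - r) / q"
  have ab: "0 < a" "0 < b" "a + b = 1" "1 < 1 / b" "a * q = r" "q * a = r" "(q - r) * (1 / b) = q" "q * b = q - r"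
    using r q by (auto simp: a_def b_def field_simps)
  obtain A where A: "A < top" "\<And>f w. f \<in> borel_measurable ((lborel :: 'c measure) \<Otimes>\<^sub>M M) \<Longrightarrow> w \<in> borel_measurable borel \<Longrightarrow>
      (\<integral>\<^sup>+x. enn_powr (fiber_norm r M (fiber_max f) x) r * w x \<partial>lborel)
        \<le> A * (\<integral>\<^sup>+x. enn_powr (fiber_norm r M f x) r * hl_max w x \<partial>lborel)"
    using fiber_max_weighted_Lr[OF r] by blast
  obtain B where B: "B < top" "\<And>f w :: 'c \<Rightarrow> ennreal. f \<in> borel_measurable borel \<Longrightarrow> w \<in> borel_measurable borel \<Longrightarrow>
      (\<integral>\<^sup>+x. enn_powr (hl_max f x) (1 / b) * w x \<partial>lborel) \<le> B * (\<integral>\<^sup>+x. enn_powr (f x) (1 / b) * hl_max w x \<partial>lborel)"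
    using hl_max_strong_type_weighted[OF ab(4)] by blast
  have "(\<integral>\<^sup>+x. enn_powr (fiber_norm r M (fiber_max f) x) q \<partial>lborel)
        \<le> enn_powr (A * enn_powr B b) (1 / a) * (\<integral>\<^sup>+x. enn_powr (fiber_norm r M f x) q \<partial>lborel)"
    if [measurable]: "f \<in> borel_measurable ((lborel :: 'c measure) \<Otimes>\<^sub>M M)" for f
  proof -
    define h where "h = fiber_norm r M f"
    have [measurable]: "h \<in> borel_measurable borel"
      unfolding h_def by measurable
    define S where "S = fiber_norm r M (fiber_max f)"
    have [measurable]: "S \<in> borel_measurable borel"
      unfolding S_def by measurable
    define H where "H = (\<integral>\<^sup>+x. enn_powr (h x) q \<partial>lborel)"
    \<comment> \<open>Truncation of \<open>S\<close>, so that the integral cancelled at the end of the duality argument is finite.\<close>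
    define U where "U N x = min (S x) (of_nat N) * indicator (ball 0 (real N)) x" for N x
    have [measurable]: "U N \<in> borel_measurable borel" for N
      unfolding U_def by measurable
    have bound: "(\<integral>\<^sup>+x. enn_powr (U N x) q \<partial>lborel) \<le> enn_powr (A * enn_powr B b) (1 / a) * H" for N
    proof -
      define I where "I = (\<integral>\<^sup>+x. enn_powr (U N x) q \<partial>lborel)"
      define w where "w x = enn_powr (U N x) (q - r)" for x
      have [measurable]: "w \<in> borel_measurable borel"
        unfolding w_def by measurable
      have "I \<le> (\<integral>\<^sup>+x. enn_powr (of_nat N) q * indicator (ball (0 :: 'c) (real N)) x \<partial>lborel)"
        unfolding I_def
      proof (intro nn_integral_mono)
        fix x
        show "enn_powr (U N x) q \<le> enn_powr (of_nat N) q * indicator (ball 0 (real N)) x"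
          using r q by (auto simp: U_def split: split_indicator intro!: enn_powr_mono)
      qed
      also have "\<dots> < top"
        using emeasure_lborel_ball_finite[of "0 :: 'c" "real N"]
        by (subst nn_integral_cmult_indicator) (auto simp: ennreal_mult_less_top of_nat_less_top)
      finally have I_fin: "I < top" .
      have "I \<le> (\<integral>\<^sup>+x. enn_powr (S x) r * w x \<partial>lborel)"
        unfolding I_def
      proof (intro nn_integral_mono)
        fix x
        have "enn_powr (U N x) q = enn_powr (U N x) r * w x"
          unfolding w_def by (subst enn_powr_add[symmetric]) simp
        also have "\<dots> \<le> enn_powr (S x) r * w x"
          using r by (intro mult_right_mono enn_powr_mono) (auto simp: U_def split: split_indicator)
        finally show "enn_powr (U N x) q \<le> enn_powr (S x) r * w x" .
      qed
      also have "\<dots> \<le> A * (\<integral>\<^sup>+x. enn_powr (h x) r * hl_max w x \<partial>lborel)"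
        unfolding S_def h_def by (intro A) auto
      also have "(\<integral>\<^sup>+x. enn_powr (h x) r * hl_max w x \<partial>lborel)
        = (\<integral>\<^sup>+x. enn_powr (enn_powr (h x) q) a * enn_powr (enn_powr (hl_max w x) (1 / b)) b \<partial>lborel)"
        using ab by (simp add: enn_powr_powr)
      also have "\<dots> \<le> enn_powr H a * enn_powr (\<integral>\<^sup>+x. enn_powr (hl_max w x) (1 / b) \<partial>lborel) b"
        unfolding H_def by (intro nn_integral_Holder ab) auto
      also have "(\<integral>\<^sup>+x. enn_powr (hl_max w x) (1 / b) \<partial>lborel) \<le> B * (\<integral>\<^sup>+x. enn_powr (w x) (1 / b) \<partial>lborel)"
        using B(2)[of w "\<lambda>_. 1"] by simp
      \<comment> \<open>The exponent q - r was chosen for this: w^(1/b) = U^q.\<close>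
      also have "(\<integral>\<^sup>+x. enn_powr (w x) (1 / b) \<partial>lborel) = I"
        unfolding w_def I_def enn_powr_powr ab ..
      finally have "I \<le> A * (enn_powr H a * enn_powr (B * I) b)"
        using ab by (simp add: mult_left_mono enn_powr_mono)
      \<comment> \<open>I splits as I^b I^a; the factor I^b is finite by truncation and cancels when
        it is nonzero.\<close>
      then have le: "enn_powr I b * enn_powr I a \<le> enn_powr I b * (A * enn_powr B b * enn_powr H a)"
        using ab by (subst enn_powr_add[symmetric]) (simp add: enn_powr_mult ac_simps)
      show ?thesis
        unfolding I_def[symmetric]
      proof (cases "I = 0")
        case False
        with I_fin le have "enn_powr I a \<le> A * enn_powr B b * enn_powr H a"
          by (simp add: ennreal_mult_le_mult_iff)
        then have "enn_powr (enn_powr I a) (1 / a) \<le> enn_powr (A * enn_powr B b * enn_powr H a) (1 / a)"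
          using ab by (intro enn_powr_mono) auto
        then show "I \<le> enn_powr (A * enn_powr B b) (1 / a) * H"
          using ab by (simp add: enn_powr_mult)
      qed simp
    qed
    have U_SUP: "S x = (SUP N. U N x)" for x
    proof (rule antisym)
      show "S x \<le> (SUP N. U N x)"
        unfolding le_SUP_iff
      proof (intro allI impI)
        fix y assume y: "y < S x"
        then have "y < top"
          using top.not_eq_extremum by fastforce
        then obtain N1 where "y < of_nat N1"
          using ennreal_Ex_less_of_nat by blast
        moreover obtain N2 where "norm x < real N2"
          using reals_Archimedean2 by blast
        ultimately have "y < U (max N1 N2) x"
          using y by (auto simp: U_def less_max_iff_disj of_nat_max)
        then show "\<exists>N\<in>UNIV. y < U N x"
          by blast
      qed
      show "(SUP N. U N x) \<le> S x"
        by (intro SUP_least) (auto simp: U_def split: split_indicator)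
    qed
    have "incseq (\<lambda>N x. enn_powr (U N x) q)"
      using r q by (intro incseq_SucI le_funI enn_powr_mono)
        (auto simp: U_def split: split_indicator intro: min.coboundedI2 add_increasing)
    have "(\<integral>\<^sup>+x. enn_powr (S x) q \<partial>lborel) = (\<integral>\<^sup>+x. (SUP N. enn_powr (U N x) q) \<partial>lborel)"
      unfolding U_SUP using r q by (simp add: enn_powr_SUP)
    also have "\<dots> = (SUP N. \<integral>\<^sup>+x. enn_powr (U N x) q \<partial>lborel)"
      using \<open>incseq (\<lambda>N x. enn_powr (U N x) q)\<close> by (intro nn_integral_monotone_convergence_SUP) auto
    also have "\<dots> \<le> enn_powr (A * enn_powr B b) (1 / a) * H"
      by (intro SUP_least bound)
    finally show ?thesis
      unfolding S_def H_def h_def .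
  qed
  moreover have "enn_powr (A * enn_powr B b) (1 / a) < top"
    using A(1) B(1) by (simp add: ennreal_mult_less_top)
  ultimately show ?thesis
    by blast
qed

lemma (in sigma_finite_measure) fiber_max_strong_type:
  assumes r: "1 < r" and q: "1 < q"
  shows "\<exists>C<top. \<forall>f. f \<in> borel_measurable ((lborel :: 'c::euclidean_space measure) \<Otimes>\<^sub>M M) \<longrightarrow>
      (AE x in lborel. fiber_norm r M f x \<le> hl_max (fiber_norm r M f) x) \<longrightarrow>
      (\<integral>\<^sup>+x. enn_powr (fiber_norm r M (fiber_max f) x) q \<partial>lborel)
        \<le> C * (\<integral>\<^sup>+x. enn_powr (fiber_norm r M f x) q \<partial>lborel)"
proof -
  consider "q < r" | "q = r" | "r < q"
    by linarith
  then show ?thesis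
  proof cases
    case 1
    then show ?thesis
      using fiber_max_strong_type_lower[OF r q] by blast
  next
    case 2
    then show ?thesis
      using fiber_max_Lr[OF r, where 'c = 'c] by blast
  next
    case 3
    then show ?thesis
      using fiber_max_strong_type_upper[OF r, where 'c = 'c] by blast
  qed
qed

text \<open>Every c below h x is exceeded on a whole ball around x, whose average is then at least
  c. For the area functional this takes the place of Lebesgue differentiation, which presupposes
  local integrability.\<close>

lemma le_hl_max_of_open_superlevel:
  assumes "\<And>c. open {x. c < h x}"
  shows "h x \<le> hl_max h x"
proof (rule dense_le)
  fix c assume "c < h x"
  then obtain e where e: "0 < e" "ball x e \<subseteq> {x. c < h x}"
    using assms[of c] open_contains_ball by blast
  have "emeasure lborel (ball x e) * c = (\<integral>\<^sup>+y. c * indicator (ball x e) y \<partial>lborel)"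
    by (subst nn_integral_cmult_indicator) (auto simp: ac_simps)
  also have "\<dots> \<le> (\<integral>\<^sup>+y. h y * indicator (ball x e) y \<partial>lborel)"
    using e(2) by (intro nn_integral_mono) (auto split: split_indicator simp: subset_eq less_imp_le)
  also have "\<dots> \<le> emeasure lborel (ball x e) * hl_max h x"
    by (rule nn_integral_ball_le_hl_max)
  finally show "c \<le> hl_max h x"
    using e(1) by (simp add: ennreal_mult_le_mult_iff emeasure_ball_pos_finite)
qed

section \<open>Local L^r estimate for the maximal function\<close>

lemma hl_max_cmult:
  assumes [measurable]: "f \<in> borel_measurable borel"
  shows "hl_max (\<lambda>y. c * f y) x = c * hl_max f x"
  unfolding hl_max_def SUP_mult_left_ennreal
  by (intro SUP_cong refl) (simp add: mult.assoc nn_integral_cmult ennreal_times_divide)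

text \<open>Let k(w) be the L^r norm of g on ball w t. Radii below t see g only on ball x (2 t),
  where the global L^r bound and a covering by balls of radius t / 2 apply. For radii s \<ge> t the
  function g is smoothed at scale t, which bounds its averages by a multiple of Mk(x) uniformly in s
  and in the centre.\<close>

lemma hl_max_local_Lr_le:
  assumes r: "1 < r"
  shows "\<exists>C<top. \<forall>(g :: 'a::euclidean_space \<Rightarrow> ennreal) x t. g \<in> borel_measurable borel \<longrightarrow> 0 < t \<longrightarrow>
    (\<integral>\<^sup>+y. enn_powr (hl_max g y) r * indicator (ball x t) y \<partial>lborel)
      \<le> C * enn_powr (hl_max (\<lambda>w. enn_powr (\<integral>\<^sup>+y. enn_powr (g y) r * indicator (ball w t) y \<partial>lborel) (1 / r)) x) r"
proof -
  define n where "n = DIM('a)"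
  obtain A where A: "A < top" "\<And>f w :: 'a \<Rightarrow> ennreal. f \<in> borel_measurable borel \<Longrightarrow> w \<in> borel_measurable borel \<Longrightarrow>
      (\<integral>\<^sup>+x. enn_powr (hl_max f x) r * w x \<partial>lborel) \<le> A * (\<integral>\<^sup>+x. enn_powr (f x) r * hl_max w x \<partial>lborel)"
    using hl_max_strong_type_weighted[OF r] by blast
  \<comment> \<open>Translated by x and scaled by t, this net covers ball x (2 t) by balls of radius
    t / 2; it is fixed before g, x and t, so its cardinality may enter the constant.\<close>
  obtain K where K: "finite K" "K \<subseteq> cball (0 :: 'a) 2" "cball (0 :: 'a) 2 \<subseteq> (\<Union>v\<in>K. ball v (1 / 2))"
    using compactE_image[of "cball (0 :: 'a) 2" "cball (0 :: 'a) 2" "\<lambda>v. ball v (1 / 2)"] by force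
  define b where "b = (r - 1) / r"
  have b: "0 < 1 / r" "0 < b" "1 / r + b = 1" "b * r = r - 1"
    using r by (auto simp: b_def field_simps)
  define C where "C = enn_powr 2 r * (A * (of_nat (card K) * enn_powr (6 ^ n) r) + enn_powr (3 ^ n) r)"
  have "(\<integral>\<^sup>+y. enn_powr (hl_max g y) r * indicator (ball x t) y \<partial>lborel)
      \<le> C * enn_powr (hl_max (\<lambda>w. enn_powr (\<integral>\<^sup>+y. enn_powr (g y) r * indicator (ball w t) y \<partial>lborel) (1 / r)) x) r"
    if [measurable]: "g \<in> borel_measurable borel" and t: "0 < t" for g :: "'a \<Rightarrow> ennreal" and x t
  proof -
    define k where "k w = enn_powr (\<integral>\<^sup>+y. enn_powr (g y) r * indicator (ball w t) y \<partial>lborel) (1 / r)" for w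
    have [measurable]: "k \<in> borel_measurable borel"
    proof -
      have "k \<in> borel_measurable lborel"
        unfolding k_def[abs_def] by measurable
      then show ?thesis
        by simp
    qed
    define m where "m = hl_max k x"
    define V where "V = emeasure lborel (ball x t)"
    have V: "V \<noteq> 0" "V \<noteq> top"
      unfolding V_def using t by (auto intro!: emeasure_ball_pos_finite simp del: emeasure_lborel_ball_finite)
    have V_eq: "emeasure lborel (ball w t) = V" for w :: 'a
      unfolding V_def using t by (simp add: emeasure_ball)
    \<comment> \<open>The radius t / 2 puts ball z (t/2) inside ball w t for each of its points w,
      so the norm of g on the small ball is below k throughout that ball. It lies in ball x (3 t),
      of six times its radius.\<close>
    have piece: "(\<integral>\<^sup>+y. enn_powr (g y) r * indicator (ball z (t / 2)) y \<partial>lborel) \<le> enn_powr (6 ^ n * m) r"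
      if z: "dist x z \<le> 2 * t" for z
    proof -
      define J where "J = (\<integral>\<^sup>+y. enn_powr (g y) r * indicator (ball z (t / 2)) y \<partial>lborel)"
      have Jk: "enn_powr J (1 / r) \<le> k w" if "w \<in> ball z (t / 2)" for w
      proof -
        have "ball z (t / 2) \<subseteq> ball w t"
        proof
          fix y assume "y \<in> ball z (t / 2)"
          then show "y \<in> ball w t"
            using that dist_triangle[of w y z] dist_commute[of w z] by simp
        qed
        then show ?thesis
          unfolding J_def k_def using r
          by (intro enn_powr_mono nn_integral_mono) (auto split: split_indicator)
      qed
      have sub: "ball z (t / 2) \<subseteq> ball x (6 * (t / 2))"
      proof
        fix y assume "y \<in> ball z (t / 2)"
        then show "y \<in> ball x (6 * (t / 2))"
          using z t dist_triangle[of x y z] by simp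
      qed
      have "emeasure lborel (ball z (t / 2)) * enn_powr J (1 / r)
        = (\<integral>\<^sup>+w. enn_powr J (1 / r) * indicator (ball z (t / 2)) w \<partial>lborel)"
        by (subst nn_integral_cmult_indicator) (auto simp: ac_simps)
      also have "\<dots> \<le> (\<integral>\<^sup>+w. k w * indicator (ball x (6 * (t / 2))) w \<partial>lborel)"
        using Jk sub by (intro nn_integral_mono) (auto split: split_indicator)
      also have "\<dots> \<le> emeasure lborel (ball x (6 * (t / 2))) * m"
        unfolding m_def by (rule nn_integral_ball_le_hl_max)
      also have "emeasure lborel (ball x (6 * (t / 2))) = 6 ^ n * emeasure lborel (ball z (t / 2))"
        unfolding n_def using t by (subst emeasure_ball_scale[of _ _ _ z]) (auto simp flip: ennreal_power)
      also have "6 ^ n * emeasure lborel (ball z (t / 2)) * m = emeasure lborel (ball z (t / 2)) * (6 ^ n * m)"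
        by (simp add: ac_simps)
      finally have "enn_powr J (1 / r) \<le> 6 ^ n * m"
        using t by (subst (asm) ennreal_mult_le_mult_iff) (auto simp: emeasure_ball_pos_finite)
      then have "enn_powr (enn_powr J (1 / r)) r \<le> enn_powr (6 ^ n * m) r"
        using r by (intro enn_powr_mono) auto
      then show ?thesis
        using r by (simp add: J_def)
    qed
    have near: "(\<integral>\<^sup>+y. enn_powr (g y) r * indicator (ball x (2 * t)) y \<partial>lborel)
        \<le> of_nat (card K) * enn_powr (6 ^ n * m) r"
    proof -
      have "(\<integral>\<^sup>+y. enn_powr (g y) r * indicator (ball x (2 * t)) y \<partial>lborel)
        \<le> (\<integral>\<^sup>+y. (\<Sum>v\<in>K. enn_powr (g y) r * indicator (ball (x + t *\<^sub>R v) (t / 2)) y) \<partial>lborel)"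
      proof (intro nn_integral_mono)
        fix y
        show "enn_powr (g y) r * indicator (ball x (2 * t)) y
          \<le> (\<Sum>v\<in>K. enn_powr (g y) r * indicator (ball (x + t *\<^sub>R v) (t / 2)) y)"
        proof (cases "y \<in> ball x (2 * t)")
          case True
          define u where "u = (y - x) /\<^sub>R t"
          have yu: "y = x + t *\<^sub>R u"
            using t by (simp add: u_def)
          have "norm u = norm (y - x) / t"
            using t by (simp add: u_def divide_inverse)
          then have "u \<in> cball 0 2"
            using True t by (simp add: dist_norm norm_minus_commute pos_divide_le_eq)
          then obtain v where v: "v \<in> K" "dist v u < 1 / 2"
            using K(3) by auto
          have "dist (x + t *\<^sub>R v) y = t * dist v u"
            using t by (simp add: yu dist_norm flip: scaleR_diff_right)
          then have "y \<in> ball (x + t *\<^sub>R v) (t / 2)"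
            using v t by simp
          then have "enn_powr (g y) r * indicator (ball x (2 * t)) y
              \<le> enn_powr (g y) r * indicator (ball (x + t *\<^sub>R v) (t / 2)) y"
            using True by simp
          also have "\<dots> \<le> (\<Sum>v\<in>K. enn_powr (g y) r * indicator (ball (x + t *\<^sub>R v) (t / 2)) y)"
            using K(1) v(1) by (intro member_le_sum) auto
          finally show ?thesis .
        qed simp
      qed
      also have "\<dots> = (\<Sum>v\<in>K. \<integral>\<^sup>+y. enn_powr (g y) r * indicator (ball (x + t *\<^sub>R v) (t / 2)) y \<partial>lborel)"
        by (intro nn_integral_sum) auto
      also have "\<dots> \<le> (\<Sum>v\<in>K. enn_powr (6 ^ n * m) r)"
      proof (intro sum_mono piece)
        fix v assume "v \<in> K"
        then have "norm v \<le> 2"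
          using K(2) by auto
        then show "dist x (x + t *\<^sub>R v) \<le> 2 * t"
          using t by (simp add: dist_norm)
      qed
      finally show ?thesis
        by simp
    qed
    \<comment> \<open>Bound for the averages at radii s \<ge> t: \<open>V^b\<close> from Holder on
      balls of volume V, 3^n from ball x (3 s), and 1 / V from the smoothing.\<close>
    define E where "E = 3 ^ n * enn_powr V b * m / V"
    have far: "(\<integral>\<^sup>+z. g z * indicator (ball y s) z \<partial>lborel) \<le> emeasure lborel (ball y s) * E"
      if y: "y \<in> ball x t" and s: "t \<le> s" for y s
    proof -
      \<comment> \<open>V is written as the integral over w of the indicator of ball z t. Exchanging
        the integrals groups the mass of g into the balls ball w t, on each of which Holder gives at
        most V^b k(w).\<close>
      have "V * (\<integral>\<^sup>+z. g z * indicator (ball y s) z \<partial>lborel)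
        = (\<integral>\<^sup>+z. g z * indicator (ball y s) z * (\<integral>\<^sup>+w. indicator (ball z t) w \<partial>lborel) \<partial>lborel)"
        by (subst nn_integral_cmult[symmetric]) (auto simp: V_eq ac_simps)
      also have "\<dots> = (\<integral>\<^sup>+z. \<integral>\<^sup>+w. g z * indicator (ball y s) z * indicator (ball z t) w \<partial>lborel \<partial>lborel)"
        by (subst nn_integral_cmult) auto
      also have "\<dots> = (\<integral>\<^sup>+w. \<integral>\<^sup>+z. g z * indicator (ball y s) z * indicator (ball z t) w \<partial>lborel \<partial>lborel)"
        by (intro lborel_pair.Fubini') measurable
      also have "\<dots> \<le> (\<integral>\<^sup>+w. enn_powr V b * (k w * indicator (ball x (3 * s)) w) \<partial>lborel)"
      proof (intro nn_integral_mono)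
        fix w
        show "(\<integral>\<^sup>+z. g z * indicator (ball y s) z * indicator (ball z t) w \<partial>lborel)
          \<le> enn_powr V b * (k w * indicator (ball x (3 * s)) w)"
        proof (cases "w \<in> ball x (3 * s)")
          case True
          have "(\<integral>\<^sup>+z. g z * indicator (ball y s) z * indicator (ball z t) w \<partial>lborel)
            \<le> (\<integral>\<^sup>+z. enn_powr (enn_powr (g z) r * indicator (ball w t) z) (1 / r) * enn_powr (indicator (ball w t) z) b \<partial>lborel)"
            using r by (intro nn_integral_mono) (auto split: split_indicator simp: dist_commute)
          also have "\<dots> \<le> enn_powr (\<integral>\<^sup>+z. enn_powr (g z) r * indicator (ball w t) z \<partial>lborel) (1 / r)
              * enn_powr (\<integral>\<^sup>+z. indicator (ball w t) z \<partial>lborel) b"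
            by (intro nn_integral_Holder b) auto
          finally show ?thesis
            using True by (simp add: k_def V_eq ac_simps)
        next
          case False
          \<comment> \<open>A nonzero integrand would force dist x w < t + s + t \<le> 3 s.\<close>
          have "g z * indicator (ball y s) z * indicator (ball z t) w = 0" for z
            using False y s dist_triangle[of x w z] dist_triangle[of x z y] by (auto split: split_indicator)
          then have "(\<integral>\<^sup>+z. g z * indicator (ball y s) z * indicator (ball z t) w \<partial>lborel) = (\<integral>\<^sup>+(z :: 'a). 0 \<partial>lborel)"
            by (rule nn_integral_cong)
          then show ?thesis
            by simp
        qed
      qed
      also have "\<dots> = enn_powr V b * (\<integral>\<^sup>+w. k w * indicator (ball x (3 * s)) w \<partial>lborel)"
        by (intro nn_integral_cmult) measurable
      also have "\<dots> \<le> enn_powr V b * (emeasure lborel (ball x (3 * s)) * m)"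
        unfolding m_def by (intro mult_left_mono nn_integral_ball_le_hl_max) auto
      also have "emeasure lborel (ball x (3 * s)) = 3 ^ n * emeasure lborel (ball y s)"
        unfolding n_def using s t by (subst emeasure_ball_scale[of _ _ _ y]) (auto simp flip: ennreal_power)
      also have "enn_powr V b * (3 ^ n * emeasure lborel (ball y s) * m) = V * (emeasure lborel (ball y s) * E)"
        using V by (simp add: E_def ennreal_times_divide mult.commute[of V] mult_divide_eq_ennreal)
          (simp add: ac_simps)
      finally show ?thesis
        using V by (simp add: ennreal_mult_le_mult_iff)
    qed
    \<comment> \<open>Because b r = r - 1, the powers of V cancel exactly and the final constant is
      independent of t.\<close>
    have E: "enn_powr E r * V = enn_powr (3 ^ n) r * enn_powr m r"
    proof -
      have "enn_powr E r * V = enn_powr V (r - 1) * V / enn_powr V r * (enn_powr (3 ^ n) r * enn_powr m r)"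
        using r by (simp add: E_def enn_powr_inverse enn_powr_mult enn_powr_powr b divide_ennreal_def ac_simps)
      also have "enn_powr V (r - 1) * V = enn_powr V r"
        using enn_powr_add[of V "r - 1" 1] by simp
      also have "enn_powr V r / enn_powr V r = 1"
        using V by (simp add: top.not_eq_extremum)
      finally show ?thesis
        by simp
    qed
    \<comment> \<open>For y in ball x t and s < t the ball of radius s about y stays inside ball x
      (2 t).\<close>
    define g2 where "g2 z = g z * indicator (ball x (2 * t)) z" for z
    have [measurable]: "g2 \<in> borel_measurable borel"
      unfolding g2_def by measurable
    have split: "hl_max g y \<le> hl_max g2 y + E" if y: "y \<in> ball x t" for y
      unfolding hl_max_le_iff
    proof (intro allI impI)
      fix s :: real assume s: "0 < s"
      show "(\<integral>\<^sup>+z. g z * indicator (ball y s) z \<partial>lborel) \<le> emeasure lborel (ball y s) * (hl_max g2 y + E)"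
      proof (cases "t \<le> s")
        case True
        then show ?thesis
          using far[OF y True] by (simp add: distrib_left add_increasing)
      next
        case False
        have "g z * indicator (ball y s) z = g2 z * indicator (ball y s) z" for z
          using False y dist_triangle[of x z y] by (auto simp: g2_def split: split_indicator)
        then have "(\<integral>\<^sup>+z. g z * indicator (ball y s) z \<partial>lborel) \<le> emeasure lborel (ball y s) * hl_max g2 y"
          by (simp add: nn_integral_ball_le_hl_max)
        then show ?thesis
          by (simp add: distrib_left add_increasing2)
      qed
    qed
    have "(\<integral>\<^sup>+y. enn_powr (hl_max g y) r * indicator (ball x t) y \<partial>lborel)
      \<le> (\<integral>\<^sup>+y. enn_powr 2 r * (enn_powr (hl_max g2 y) r + enn_powr E r * indicator (ball x t) y) \<partial>lborel)"
    proof (intro nn_integral_mono)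
      fix y
      show "enn_powr (hl_max g y) r * indicator (ball x t) y
        \<le> enn_powr 2 r * (enn_powr (hl_max g2 y) r + enn_powr E r * indicator (ball x t) y)"
      proof (cases "y \<in> ball x t")
        case True
        then have "enn_powr (hl_max g y) r \<le> enn_powr (hl_max g2 y + E) r"
          using r by (intro enn_powr_mono split) auto
        also have "\<dots> \<le> enn_powr 2 r * (enn_powr (hl_max g2 y) r + enn_powr E r)"
          using r by (intro enn_powr_plus_le) auto
        finally show ?thesis
          using True by simp
      qed simp
    qed
    also have "\<dots> = enn_powr 2 r * ((\<integral>\<^sup>+y. enn_powr (hl_max g2 y) r \<partial>lborel) + enn_powr E r * V)"
      by (simp add: nn_integral_cmult nn_integral_add nn_integral_cmult_indicator V_def)
    also have "(\<integral>\<^sup>+y. enn_powr (hl_max g2 y) r \<partial>lborel) \<le> A * (\<integral>\<^sup>+y. enn_powr (g2 y) r \<partial>lborel)"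
      using A(2)[of g2 "\<lambda>_. 1"] by simp
    also have "(\<integral>\<^sup>+y. enn_powr (g2 y) r \<partial>lborel) = (\<integral>\<^sup>+y. enn_powr (g y) r * indicator (ball x (2 * t)) y \<partial>lborel)"
      by (intro nn_integral_cong) (auto simp: g2_def split: split_indicator)
    also have "\<dots> \<le> of_nat (card K) * enn_powr (6 ^ n * m) r"
      by (rule near)
    also have "enn_powr 2 r * (A * (of_nat (card K) * enn_powr (6 ^ n * m) r) + enn_powr E r * V) = C * enn_powr m r"
      unfolding E by (simp add: C_def enn_powr_mult distrib_left distrib_right ac_simps)
    finally show ?thesis
      unfolding m_def k_def by (simp add: mult_left_mono add_right_mono)
  qed
  moreover have "C < top"
    unfolding C_def using A(1) by (simp add: ennreal_mult_less_top power_less_top_ennreal of_nat_less_top)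
  ultimately show ?thesis
    by blast
qed

section \<open>Tent spaces\<close>

text \<open>Nonnegative integrals are suprema over simple functions, and completing the measure does
  not change them, even for a nonmeasurable integrand. This covers slices of F that fail to be
  measurable.\<close>

lemma maximal_fn_eq_hl_max: "maximal_fn f x = hl_max (\<lambda>y. ennreal (cmod (f y))) x"
  unfolding maximal_fn_def hl_max_def by (simp add: nn_integral_completion)

text \<open>Absorbing the density t^(-n-1) makes the area functional a plain L^r norm in t. The
  radius ranges over all of \<open>lborel\<close>, hence the indicator of t > 0.\<close>

definition cone_avg :: "real \<Rightarrow> ('a::euclidean_space \<times> real \<Rightarrow> ennreal) \<Rightarrow> 'a \<times> real \<Rightarrow> ennreal" where
  "cone_avg r G z = enn_powr (indicator {0<..} (snd z) *
     (\<integral>\<^sup>+y. enn_powr (G (y, snd z)) r * indicator (ball (fst z) (snd z)) y \<partial>lborel)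
       / ennreal (snd z ^ (DIM('a) + 1))) (1 / r)"

lemma borel_measurable_cone_avg [measurable]:
  assumes [measurable]: "G \<in> borel_measurable (lborel \<Otimes>\<^sub>M lborel)"
  shows "cone_avg r G \<in> borel_measurable (lborel \<Otimes>\<^sub>M lborel)"
  unfolding cone_avg_def[abs_def] by measurable

lemma area_fn_cong_AE:
  assumes "AE z in lborel. F z = G z"
  shows "area_fn r F x = area_fn r G x"
  unfolding area_fn_def nn_integral_completion
  by (intro arg_cong[where f = "\<lambda>u. enn_powr u (1 / r)"] nn_integral_cong_AE) (use assms in eventually_elim, simp)

lemma area_fn_eq_iterated:
  fixes G :: "'a::euclidean_space \<times> real \<Rightarrow> ennreal"
  assumes [measurable]: "G \<in> borel_measurable (lborel \<Otimes>\<^sub>M lborel)"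
  shows "area_fn r G x = enn_powr (\<integral>\<^sup>+t. indicator {0<..} t *
     (\<integral>\<^sup>+y. enn_powr (G (y, t)) r * indicator (ball x t) y \<partial>lborel) / ennreal (t ^ (DIM('a) + 1)) \<partial>lborel) (1 / r)"
proof -
  define u where "u z = enn_powr (G z) r / ennreal (snd z ^ (DIM('a) + 1))
      * (indicator {0<..} (snd z) * indicator (ball x (snd z)) (fst z))" for z
  have [measurable]: "u \<in> borel_measurable (lborel \<Otimes>\<^sub>M lborel)"
    unfolding u_def by measurable
  have "(\<integral>\<^sup>+ z \<in> {(y, t). 0 < t \<and> y \<in> ball x t}. enn_powr (G z) r / ennreal (snd z ^ (DIM('a) + 1)) \<partial>lebesgue)
    = (\<integral>\<^sup>+z. u z \<partial>lborel)"
    unfolding nn_integral_completion u_def by (intro nn_integral_cong) (auto split: split_indicator)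
  also have "\<dots> = (\<integral>\<^sup>+z. u z \<partial>(lborel \<Otimes>\<^sub>M lborel))"
    by (simp add: lborel_prod)
  also have "\<dots> = (\<integral>\<^sup>+t. \<integral>\<^sup>+y. u (y, t) \<partial>lborel \<partial>lborel)"
    by (intro lborel_pair.nn_integral_snd[symmetric]) simp
  also have "\<dots> = (\<integral>\<^sup>+t. indicator {0<..} t *
     (\<integral>\<^sup>+y. enn_powr (G (y, t)) r * indicator (ball x t) y \<partial>lborel) / ennreal (t ^ (DIM('a) + 1)) \<partial>lborel)"
  proof (intro nn_integral_cong)
    fix t
    have [measurable]: "(\<lambda>y. G (y, t)) \<in> borel_measurable lborel"
      by measurable
    have "(\<integral>\<^sup>+y. u (y, t) \<partial>lborel) = (\<integral>\<^sup>+y. (indicator {0<..} t / ennreal (t ^ (DIM('a) + 1)))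
        * (enn_powr (G (y, t)) r * indicator (ball x t) y) \<partial>lborel)"
      unfolding u_def by (intro nn_integral_cong) (simp add: divide_ennreal_def ac_simps)
    also have "\<dots> = (indicator {0<..} t / ennreal (t ^ (DIM('a) + 1)))
        * (\<integral>\<^sup>+y. enn_powr (G (y, t)) r * indicator (ball x t) y \<partial>lborel)"
      by (intro nn_integral_cmult) measurable
    finally show "(\<integral>\<^sup>+y. u (y, t) \<partial>lborel) = indicator {0<..} t *
       (\<integral>\<^sup>+y. enn_powr (G (y, t)) r * indicator (ball x t) y \<partial>lborel) / ennreal (t ^ (DIM('a) + 1))"
      by (simp add: divide_ennreal_def ac_simps)
  qed
  finally show ?thesis
    unfolding area_fn_def by simp
qed

lemma area_fn_eq_fiber_norm:
  assumes "G \<in> borel_measurable (lborel \<Otimes>\<^sub>M lborel)" "0 < r"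
  shows "area_fn r G = fiber_norm r lborel (cone_avg r G)"
  using assms by (simp add: fun_eq_iff area_fn_eq_iterated fiber_norm_def cone_avg_def)

text \<open>A given point of the upper half space lies in the cone over x for an open set of x, so
  the Fatou argument of \<open>open_superlevel_nn_integral\<close> applies.\<close>

lemma open_superlevel_area_fn:
  fixes G :: "'a::euclidean_space \<times> real \<Rightarrow> ennreal"
  assumes [measurable]: "G \<in> borel_measurable (lborel \<Otimes>\<^sub>M lborel)" and r: "0 < r"
  shows "open {x. c < area_fn r G x}"
proof -
  have iff: "c < enn_powr u (1 / r) \<longleftrightarrow> enn_powr c r < u" for u
    using enn_powr_less_iff[of r c "enn_powr u (1 / r)"] r by simp
  show ?thesis
    unfolding area_fn_def iff nn_integral_completion
  proof (rule open_superlevel_nn_integral)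
    show "(\<lambda>z. enn_powr (G z) r / ennreal (snd z ^ (DIM('a) + 1))) \<in> borel_measurable lborel"
      unfolding lborel_prod[symmetric] by measurable
    fix x :: 'a
    have "open {z. 0 < snd z \<and> dist x (fst z) < snd z}"
      by (intro open_Collect_conj open_Collect_less continuous_intros)
    moreover have "{z. 0 < snd z \<and> dist x (fst z) < snd z} = {(y, t). 0 < t \<and> y \<in> ball x t}"
      by auto
    ultimately show "{(y, t). 0 < t \<and> y \<in> ball x t} \<in> sets lborel"
      by simp
  next
    fix z :: "'a \<times> real"
    show "open {x. z \<in> {(y, t). 0 < t \<and> y \<in> ball x t}}"
      by (cases z) (auto intro!: open_Collect_conj open_in_center_ball simp del: mem_ball)
  qed
qed

text \<open>A null set of the product has null slices at almost every t. At such t the slices of |F|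
  and G agree almost everywhere, so their maximal functions agree at every point. This is what
  permits replacing |F| by a Borel representative.\<close>

lemma tent_max_AE_eq_fiber_max:
  fixes F :: "'a::euclidean_space \<times> real \<Rightarrow> complex" and G :: "'a \<times> real \<Rightarrow> ennreal"
  assumes eq: "AE z in lborel. ennreal (cmod (F z)) = G z"
  shows "AE z in lborel. tent_max F z = fiber_max G z"
proof -
  obtain N where N: "{z. ennreal (cmod (F z)) \<noteq> G z} \<subseteq> N" "N \<in> null_sets lborel"
    using eq by (auto simp: eventually_ae_filter)
  have [measurable]: "N \<in> sets (lborel \<Otimes>\<^sub>M lborel)"
    using N(2) unfolding lborel_prod by (rule null_setsD2)
  have "AE z in (lborel \<Otimes>\<^sub>M lborel). z \<notin> N"
    using N(2) unfolding lborel_prod by (rule AE_not_in)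
  \<comment> \<open>This is the wrong order of slicing; measurability of N allows the two
    quantifiers to be exchanged.\<close>
  then have "AE y in lborel. AE t in lborel. (y, t) \<notin> N"
    by (rule lborel_pair.AE_pair)
  moreover have "{z \<in> space (lborel \<Otimes>\<^sub>M lborel). (fst z, snd z) \<notin> N} \<in> sets (lborel \<Otimes>\<^sub>M lborel)"
    by measurable
  ultimately have "AE t in lborel. AE y in lborel. (y, t) \<notin> N"
    using lborel_pair.AE_commute[where P = "\<lambda>y t. (y, t) \<notin> N"] by blast
  then obtain T where T: "{t. \<not> (AE y in lborel. (y, t) \<notin> N)} \<subseteq> T" "T \<in> null_sets lborel"
    by (auto simp: eventually_ae_filter[where P = "\<lambda>t. AE y in lborel. (y, t) \<notin> N"])
  then have [measurable]: "T \<in> sets borel"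
    by auto
  have slice: "tent_max F (y, t) = fiber_max G (y, t)" if "t \<notin> T" for y t
  proof -
    have "AE y in lborel. (y, t) \<notin> N"
      using T(1) that by auto
    then have "AE y in lborel. ennreal (cmod (F (y, t))) = G (y, t)"
      by eventually_elim (use N(1) in auto)
    then show ?thesis
      unfolding tent_max_def fiber_max_def maximal_fn_eq_hl_max by (simp add: hl_max_cong_AE)
  qed
  have "{z \<in> space (lborel \<Otimes>\<^sub>M lborel). snd z \<notin> T} \<in> sets (lborel \<Otimes>\<^sub>M lborel)"
    by measurable
  then have "AE z in (lborel \<Otimes>\<^sub>M lborel). snd z \<notin> T"
    by (rule lborel_pair.AE_pair_measure) (simp add: AE_not_in[OF T(2)])
  then show ?thesis
    unfolding lborel_prod by eventually_elim (metis slice prod.collapse)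
qed

text \<open>The local estimate is used at each fixed t, with the factor t^(-n-1) moved inside the
  maximal operator by homogeneity, and then integrated in t.\<close>

lemma area_fn_fiber_max_le:
  assumes r: "1 < r"
  shows "\<exists>C<top. \<forall>G x. G \<in> borel_measurable ((lborel :: 'a::euclidean_space measure) \<Otimes>\<^sub>M lborel) \<longrightarrow>
    area_fn r (fiber_max G) x \<le> C * fiber_norm r lborel (fiber_max (cone_avg r G)) x"
proof -
  obtain A where A: "A < top" "\<And>(g :: 'a \<Rightarrow> ennreal) x t. g \<in> borel_measurable borel \<Longrightarrow> 0 < t \<Longrightarrow>
    (\<integral>\<^sup>+y. enn_powr (hl_max g y) r * indicator (ball x t) y \<partial>lborel)
      \<le> A * enn_powr (hl_max (\<lambda>w. enn_powr (\<integral>\<^sup>+y. enn_powr (g y) r * indicator (ball w t) y \<partial>lborel) (1 / r)) x) r"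
    using hl_max_local_Lr_le[OF r] by blast
  have "area_fn r (fiber_max G) x \<le> enn_powr A (1 / r) * fiber_norm r lborel (fiber_max (cone_avg r G)) x"
    if [measurable]: "G \<in> borel_measurable ((lborel :: 'a measure) \<Otimes>\<^sub>M lborel)" for G x
  proof -
    have slice: "indicator {0<..} t * (\<integral>\<^sup>+y. enn_powr (fiber_max G (y, t)) r * indicator (ball x t) y \<partial>lborel)
        / ennreal (t ^ (DIM('a) + 1)) \<le> A * enn_powr (fiber_max (cone_avg r G) (x, t)) r" for t
    proof (cases "0 < t")
      case True
      define k where "k w = enn_powr (\<integral>\<^sup>+y. enn_powr (G (y, t)) r * indicator (ball w t) y \<partial>lborel) (1 / r)" for w
      have [measurable]: "(\<lambda>y. G (y, t)) \<in> borel_measurable lborel"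
        by measurable
      have [measurable]: "k \<in> borel_measurable borel"
      proof -
        have "k \<in> borel_measurable lborel"
          unfolding k_def[abs_def] by measurable
        then show ?thesis
          by simp
      qed
      define c where "c = inverse (ennreal (t ^ (DIM('a) + 1)))"
      have "cone_avg r G (w, t) = enn_powr c (1 / r) * k w" for w
        using True by (simp add: cone_avg_def k_def c_def divide_ennreal_def enn_powr_mult ac_simps)
      then have "fiber_max (cone_avg r G) (x, t) = enn_powr c (1 / r) * hl_max k x"
        by (simp add: fiber_max_def hl_max_cmult)
      then have "enn_powr (fiber_max (cone_avg r G) (x, t)) r = c * enn_powr (hl_max k x) r"
        using r by (simp add: enn_powr_mult)
      moreover have "(\<integral>\<^sup>+y. enn_powr (hl_max (\<lambda>y. G (y, t)) y) r * indicator (ball x t) y \<partial>lborel)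
          \<le> A * enn_powr (hl_max k x) r"
        unfolding k_def using True by (intro A(2)) simp_all
      then have "c * (\<integral>\<^sup>+y. enn_powr (hl_max (\<lambda>y. G (y, t)) y) r * indicator (ball x t) y \<partial>lborel)
          \<le> c * (A * enn_powr (hl_max k x) r)"
        by (rule mult_left_mono) simp
      ultimately show ?thesis
        using True by (simp add: fiber_max_def divide_ennreal_def c_def ac_simps)
    qed simp
    have "area_fn r (fiber_max G) x \<le> enn_powr (\<integral>\<^sup>+t. A * enn_powr (fiber_max (cone_avg r G) (x, t)) r \<partial>lborel) (1 / r)"
      using r by (subst area_fn_eq_iterated) (auto intro!: enn_powr_mono nn_integral_mono slice[simplified])
    also have "\<dots> = enn_powr A (1 / r) * fiber_norm r lborel (fiber_max (cone_avg r G)) x"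
      by (subst nn_integral_cmult) (auto simp: fiber_norm_def enn_powr_mult)
    finally show ?thesis .
  qed
  moreover have "enn_powr A (1 / r) < top"
    using A(1) by simp
  ultimately show ?thesis
    by blast
qed

text \<open>Interface to the vector-valued theory: f is \<open>cone_avg\<close> of a Borel
  representative of |F|, and C is chosen before F.\<close>

lemma area_fn_tent_max_reduction:
  assumes r: "1 < r"
  shows "\<exists>C<top. \<forall>F. F \<in> borel_measurable (lebesgue :: ('a::euclidean_space \<times> real) measure) \<longrightarrow>
    (\<exists>f. f \<in> borel_measurable ((lborel :: 'a measure) \<Otimes>\<^sub>M (lborel :: real measure)) \<and>
      area_fn r (\<lambda>z. ennreal (cmod (F z))) = fiber_norm r lborel f \<and>
      (\<forall>x. fiber_norm r lborel f x \<le> hl_max (fiber_norm r lborel f) x) \<and>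
      (\<forall>x. area_fn r (tent_max F) x \<le> C * fiber_norm r lborel (fiber_max f) x))"
proof -
  obtain C where C: "C < top" "\<And>G x. G \<in> borel_measurable ((lborel :: 'a measure) \<Otimes>\<^sub>M lborel) \<Longrightarrow>
    area_fn r (fiber_max G) x \<le> C * fiber_norm r lborel (fiber_max (cone_avg r G)) x"
    using area_fn_fiber_max_le[OF r] by blast
  have "\<exists>f. f \<in> borel_measurable ((lborel :: 'a measure) \<Otimes>\<^sub>M (lborel :: real measure)) \<and>
      area_fn r (\<lambda>z. ennreal (cmod (F z))) = fiber_norm r lborel f \<and>
      (\<forall>x. fiber_norm r lborel f x \<le> hl_max (fiber_norm r lborel f) x) \<and>
      (\<forall>x. area_fn r (tent_max F) x \<le> C * fiber_norm r lborel (fiber_max f) x)"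
    if [measurable]: "F \<in> borel_measurable (lebesgue :: ('a \<times> real) measure)" for F
  proof -
    have "(\<lambda>z. ennreal (cmod (F z))) \<in> borel_measurable lebesgue"
      by measurable
    then obtain G where G: "G \<in> borel_measurable lborel" "AE z in lborel. ennreal (cmod (F z)) = G z"
      using completion_ex_borel_measurable by blast
    have Gm [measurable]: "G \<in> borel_measurable (lborel \<Otimes>\<^sub>M lborel)"
      using G(1) by (simp add: lborel_prod)
    have eq: "area_fn r (\<lambda>z. ennreal (cmod (F z))) = area_fn r G"
      using area_fn_cong_AE[OF G(2)] by (simp add: fun_eq_iff)
    have norm: "area_fn r G = fiber_norm r lborel (cone_avg r G)"
      using r by (intro area_fn_eq_fiber_norm) auto
    have "area_fn r G x \<le> hl_max (area_fn r G) x" for x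
      using r by (intro le_hl_max_of_open_superlevel open_superlevel_area_fn) auto
    moreover have "area_fn r (tent_max F) x = area_fn r (fiber_max G) x" for x
      by (rule area_fn_cong_AE[OF tent_max_AE_eq_fiber_max[OF G(2)]])
    ultimately show ?thesis
      using eq norm C(2)[OF Gm] by (intro exI[of _ "cone_avg r G"]) simp
  qed
  with C(1) show ?thesis
    by blast
qed

lemma Lq_norm_eq: "Lq_norm q g = enn_powr (\<integral>\<^sup>+x. enn_powr (g x) q \<partial>lborel) (1 / q)"
  by (simp add: Lq_norm_def nn_integral_completion)

theorem theorem2p1:
  fixes r :: real
  assumes "1 < r"
  shows "(\<forall>q::real. 1 < q \<longrightarrow>
            (\<exists>C::real. \<forall>F :: 'a::euclidean_space \<times> real \<Rightarrow> complex.
               F \<in> borel_measurable lebesgue \<and>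
               Lq_norm q (area_fn r (\<lambda>z. ennreal (cmod (F z)))) < \<infinity> \<longrightarrow>
               Lq_norm q (area_fn r (tent_max F))
                 \<le> ennreal C * Lq_norm q (area_fn r (\<lambda>z. ennreal (cmod (F z))))))
       \<and> (\<exists>C::real. \<forall>F :: 'a \<times> real \<Rightarrow> complex.
               F \<in> borel_measurable lebesgue \<and>
               Lq_norm 1 (area_fn r (\<lambda>z. ennreal (cmod (F z)))) < \<infinity> \<longrightarrow>
               weak_L1_norm (area_fn r (tent_max F))
                 \<le> ennreal C * Lq_norm 1 (area_fn r (\<lambda>z. ennreal (cmod (F z)))))"
proof -
  obtain A where A: "A < top" "\<And>F. F \<in> borel_measurable (lebesgue :: ('a \<times> real) measure) \<Longrightarrow>
    (\<exists>f. f \<in> borel_measurable ((lborel :: 'a measure) \<Otimes>\<^sub>M (lborel :: real measure)) \<and>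
      area_fn r (\<lambda>z. ennreal (cmod (F z))) = fiber_norm r lborel f \<and>
      (\<forall>x. fiber_norm r lborel f x \<le> hl_max (fiber_norm r lborel f) x) \<and>
      (\<forall>x. area_fn r (tent_max F) x \<le> A * fiber_norm r lborel (fiber_max f) x))"
    using area_fn_tent_max_reduction[OF assms] by blast
  show ?thesis
  proof (intro conjI allI impI)
    fix q :: real assume q: "1 < q"
    obtain B where B: "B < top" "\<And>f. f \<in> borel_measurable ((lborel :: 'a measure) \<Otimes>\<^sub>M (lborel :: real measure)) \<Longrightarrow>
      (AE x in lborel. fiber_norm r lborel f x \<le> hl_max (fiber_norm r lborel f) x) \<Longrightarrow>
      (\<integral>\<^sup>+x. enn_powr (fiber_norm r lborel (fiber_max f) x) q \<partial>lborel)
        \<le> B * (\<integral>\<^sup>+x. enn_powr (fiber_norm r lborel f x) q \<partial>lborel)"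
      using lborel.fiber_max_strong_type[OF assms q] by blast
    define C where "C = A * enn_powr B (1 / q)"
    have "Lq_norm q (area_fn r (tent_max F)) \<le> ennreal (enn2real C) * Lq_norm q (area_fn r (\<lambda>z. ennreal (cmod (F z))))"
      if F: "F \<in> borel_measurable lebesgue" for F :: "'a \<times> real \<Rightarrow> complex"
    proof -
      obtain f where f: "f \<in> borel_measurable ((lborel :: 'a measure) \<Otimes>\<^sub>M (lborel :: real measure))"
        "area_fn r (\<lambda>z. ennreal (cmod (F z))) = fiber_norm r lborel f"
        "\<And>x. fiber_norm r lborel f x \<le> hl_max (fiber_norm r lborel f) x"
        "\<And>x. area_fn r (tent_max F) x \<le> A * fiber_norm r lborel (fiber_max f) x"
        using A(2)[OF F] by blast
      note [measurable] = f(1)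
      have "(\<integral>\<^sup>+x. enn_powr (area_fn r (tent_max F) x) q \<partial>lborel)
        \<le> (\<integral>\<^sup>+x. enn_powr (A * fiber_norm r lborel (fiber_max f) x) q \<partial>lborel)"
        using q by (intro nn_integral_mono enn_powr_mono f(4)) auto
      also have "\<dots> = enn_powr A q * (\<integral>\<^sup>+x. enn_powr (fiber_norm r lborel (fiber_max f) x) q \<partial>lborel)"
        by (simp add: enn_powr_mult nn_integral_cmult)
      also have "\<dots> \<le> enn_powr A q * (B * (\<integral>\<^sup>+x. enn_powr (fiber_norm r lborel f x) q \<partial>lborel))"
        using f(1,3) by (intro mult_left_mono B(2)) auto
      finally have "Lq_norm q (area_fn r (tent_max F))
        \<le> enn_powr (enn_powr A q * (B * (\<integral>\<^sup>+x. enn_powr (fiber_norm r lborel f x) q \<partial>lborel))) (1 / q)"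
        unfolding Lq_norm_eq using q by (intro enn_powr_mono) auto
      also have "\<dots> = C * Lq_norm q (fiber_norm r lborel f)"
        using q by (simp add: C_def Lq_norm_eq enn_powr_mult mult.assoc)
      also have "C = ennreal (enn2real C)"
        using A(1) B(1) by (simp add: C_def ennreal_mult_less_top)
      finally show ?thesis
        by (simp add: f(2))
    qed
    then show "\<exists>C::real. \<forall>F :: 'a \<times> real \<Rightarrow> complex.
               F \<in> borel_measurable lebesgue \<and>
               Lq_norm q (area_fn r (\<lambda>z. ennreal (cmod (F z)))) < \<infinity> \<longrightarrow>
               Lq_norm q (area_fn r (tent_max F))
                 \<le> ennreal C * Lq_norm q (area_fn r (\<lambda>z. ennreal (cmod (F z))))"
      by blast
  next
    obtain B where B: "B < top" "\<And>f l. f \<in> borel_measurable ((lborel :: 'a measure) \<Otimes>\<^sub>M (lborel :: real measure)) \<Longrightarrow>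
      (AE x in lborel. fiber_norm r lborel f x \<le> hl_max (fiber_norm r lborel f) x) \<Longrightarrow> 0 < l \<Longrightarrow>
      ennreal l * emeasure lborel {x. ennreal l < fiber_norm r lborel (fiber_max f) x}
        \<le> B * (\<integral>\<^sup>+x. fiber_norm r lborel f x \<partial>lborel)"
      using lborel.fiber_max_weak_type[OF assms] by blast
    \<comment> \<open>The level s is divided by this bound for A, so it must be real and strictly
      positive.\<close>
    define d where "d = enn2real A + 1"
    have d: "0 < d" "A \<le> ennreal d"
      using A(1) by (auto simp: d_def add_nonneg_pos)
    define C where "C = ennreal d * B"
    have "weak_L1_norm (area_fn r (tent_max F)) \<le> ennreal (enn2real C) * Lq_norm 1 (area_fn r (\<lambda>z. ennreal (cmod (F z))))"
      if F: "F \<in> borel_measurable lebesgue" for F :: "'a \<times> real \<Rightarrow> complex"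
    proof -
      obtain f where f: "f \<in> borel_measurable ((lborel :: 'a measure) \<Otimes>\<^sub>M (lborel :: real measure))"
        "area_fn r (\<lambda>z. ennreal (cmod (F z))) = fiber_norm r lborel f"
        "\<And>x. fiber_norm r lborel f x \<le> hl_max (fiber_norm r lborel f) x"
        "\<And>x. area_fn r (tent_max F) x \<le> A * fiber_norm r lborel (fiber_max f) x"
        using A(2)[OF F] by blast
      note [measurable] = f(1)
      define S where "S = fiber_norm r lborel (fiber_max f)"
      have [measurable]: "S \<in> borel_measurable borel"
        unfolding S_def by measurable
      have "ennreal s * emeasure lebesgue {x. ennreal s < area_fn r (tent_max F) x}
        \<le> C * (\<integral>\<^sup>+x. fiber_norm r lborel f x \<partial>lborel)" if s: "0 < s" for s
      proof -
        have s_eq: "ennreal s = ennreal d * ennreal (s / d)"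
          using s d by (simp flip: ennreal_mult)
        have "{x. ennreal s < area_fn r (tent_max F) x} \<subseteq> {x. ennreal (s / d) < S x}"
        proof (safe, rule ccontr)
          fix x assume x: "ennreal s < area_fn r (tent_max F) x" "\<not> ennreal (s / d) < S x"
          have "area_fn r (tent_max F) x \<le> ennreal d * S x"
            unfolding S_def by (rule order_trans[OF f(4)]) (intro mult_right_mono d, simp)
          also have "\<dots> \<le> ennreal s"
            unfolding s_eq using x(2) by (intro mult_left_mono) auto
          finally show False
            using x(1) by simp
        qed
        \<comment> \<open>Monotonicity of the measure asks only for the larger set to be measurable,
          and S is Borel.\<close>
        then have "emeasure lebesgue {x. ennreal s < area_fn r (tent_max F) x} \<le> emeasure lebesgue {x. ennreal (s / d) < S x}"
          by (intro emeasure_mono) auto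
        then have "ennreal s * emeasure lebesgue {x. ennreal s < area_fn r (tent_max F) x}
          \<le> ennreal d * (ennreal (s / d) * emeasure lborel {x. ennreal (s / d) < S x})"
          unfolding s_eq by (simp add: mult.assoc mult_left_mono)
        also have "\<dots> \<le> ennreal d * (B * (\<integral>\<^sup>+x. fiber_norm r lborel f x \<partial>lborel))"
          unfolding S_def using f(1,3) s d by (intro mult_left_mono B(2)) auto
        finally show ?thesis
          by (simp add: C_def mult.assoc)
      qed
      then have "weak_L1_norm (area_fn r (tent_max F)) \<le> C * Lq_norm 1 (fiber_norm r lborel f)"
        unfolding weak_L1_norm_def Lq_norm_eq by (intro SUP_least) simp
      also have "C = ennreal (enn2real C)"
        using B(1) by (simp add: C_def ennreal_mult_less_top)
      finally show ?thesis
        by (simp add: f(2))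
    qed
    then show "\<exists>C::real. \<forall>F :: 'a \<times> real \<Rightarrow> complex.
               F \<in> borel_measurable lebesgue \<and>
               Lq_norm 1 (area_fn r (\<lambda>z. ennreal (cmod (F z)))) < \<infinity> \<longrightarrow>
               weak_L1_norm (area_fn r (tent_max F))
                 \<le> ennreal C * Lq_norm 1 (area_fn r (\<lambda>z. ennreal (cmod (F z))))"
      by blast
  qed
qed

end
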